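(* Let $k$ be a commutative ring with unit. For $a\in\mathbb{N}$, the functor $\overline{k[-]}^{\otimes a}$ is not projective in $\mathcal{F}(\overline{\mathbf{Fin}};k)$.
   Context: $\mathbb{N}$ denotes the non-negative integers. $\overline{\mathbf{Fin}}$ is the category of finite non-empty sets and all maps. $\mathcal{F}(\overline{\mathbf{Fin}};k)$ is the abelian category of functors from $\overline{\mathbf{Fin}}$ to $k$-modules, with the pointwise tensor product over $k$. The functor $\overline{k[-]}$ sends a finite non-empty set $X$ to the kernel of the augmentation $k[X]\to k$, $[x]\mapsto 1$, where $k[X]$ is the free $k$-module on $X$; $\overline{k[-]}^{\otimes 0}$ is the constant functor with value $k$.
   Formalization: The commutative ring k is assumed to be nonzero; for the zero ring every functor to k-modules is zero and hence projective, so the claim as stated fails in that case. *)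

theory Defs
  imports "HOL-Algebra.Module" "HOL-Algebra.AbelCoset"
begin

section \<open>Modules over a commutative ring\<close>

definition mod_hom ::
    "('k, 'r) ring_scheme \<Rightarrow> ('k, 'm) module \<Rightarrow> ('k, 'n) module \<Rightarrow> ('m \<Rightarrow> 'n) set"
  where "mod_hom R M N =
    {h \<in> carrier M \<rightarrow> carrier N.
       (\<forall>u \<in> carrier M. \<forall>v \<in> carrier M. h (u \<oplus>\<^bsub>M\<^esub> v) = h u \<oplus>\<^bsub>N\<^esub> h v) \<and>
       (\<forall>c \<in> carrier R. \<forall>v \<in> carrier M. h (c \<odot>\<^bsub>M\<^esub> v) = c \<odot>\<^bsub>N\<^esub> h v)}"

text \<open>The fields \<open>mult\<close> and \<open>one\<close> that the record type \<open>module\<close> inherits from rings play no role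
  and are left unspecified. The free module on \<open>S\<close> consists of the finitely supported
  \<open>R\<close>-valued functions on \<open>S\<close>, extended by zero.\<close>

definition free_module :: "('k, 'r) ring_scheme \<Rightarrow> 's set \<Rightarrow> ('k, 's \<Rightarrow> 'k) module"
  where "free_module R S =
    \<lparr>carrier = {\<phi>. (\<forall>s. \<phi> s \<in> carrier R) \<and> (\<forall>s. s \<notin> S \<longrightarrow> \<phi> s = \<zero>\<^bsub>R\<^esub>) \<and> finite {s. \<phi> s \<noteq> \<zero>\<^bsub>R\<^esub>}},
     mult = undefined, one = undefined,
     zero = (\<lambda>s. \<zero>\<^bsub>R\<^esub>),
     add = (\<lambda>\<phi> \<psi> s. \<phi> s \<oplus>\<^bsub>R\<^esub> \<psi> s),
     smult = (\<lambda>c \<phi> s. c \<otimes>\<^bsub>R\<^esub> \<phi> s)\<rparr>"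

definition free_gen :: "('k, 'r) ring_scheme \<Rightarrow> 's \<Rightarrow> 's \<Rightarrow> 'k"
  where "free_gen R s = (\<lambda>t. if t = s then \<one>\<^bsub>R\<^esub> else \<zero>\<^bsub>R\<^esub>)"

text \<open>The linear map \<open>k[S] \<rightarrow> k[T]\<close>, \<open>[s] \<mapsto> [f s]\<close>, and the augmentation \<open>k[S] \<rightarrow> k\<close>, \<open>[s] \<mapsto> 1\<close>.\<close>

definition free_map :: "('k, 'r) ring_scheme \<Rightarrow> ('s \<Rightarrow> 't) \<Rightarrow> ('s \<Rightarrow> 'k) \<Rightarrow> 't \<Rightarrow> 'k"
  where "free_map R f \<phi> = (\<lambda>t. \<Oplus>\<^bsub>R\<^esub> s \<in> {s. \<phi> s \<noteq> \<zero>\<^bsub>R\<^esub> \<and> f s = t}. \<phi> s)"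

definition augmentation :: "('k, 'r) ring_scheme \<Rightarrow> ('s \<Rightarrow> 'k) \<Rightarrow> 'k"
  where "augmentation R \<phi> = (\<Oplus>\<^bsub>R\<^esub> s \<in> {s. \<phi> s \<noteq> \<zero>\<^bsub>R\<^esub>}. \<phi> s)"

definition gen_submodule :: "('k, 'r) ring_scheme \<Rightarrow> ('k, 'm) module \<Rightarrow> 'm set \<Rightarrow> 'm set"
  where "gen_submodule R M A = \<Inter>{H. submodule H R M \<and> A \<subseteq> H}"

definition quot_module :: "('k, 'm) module \<Rightarrow> 'm set \<Rightarrow> ('k, 'm set) module"
  where "quot_module M H =
    \<lparr>carrier = a_rcosets\<^bsub>M\<^esub> H,
     mult = undefined, one = undefined,
     zero = H,
     add = set_add M,
     smult = (\<lambda>c C. \<Union>v \<in> C. H +>\<^bsub>M\<^esub> (c \<odot>\<^bsub>M\<^esub> v))\<rparr>"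


section \<open>Tensor powers of modules\<close>

text \<open>The \<open>a\<close>-fold tensor power is the free module on the \<open>a\<close>-tuples in \<open>M\<close> modulo the
  multilinearity relations. It is defined for all \<open>a\<close> at once, because iterating a binary
  tensor product would change the type with \<open>a\<close>. For \<open>a = 0\<close> there is just the empty tuple and
  there are no relations, which gives \<open>k\<close>.\<close>

definition tuples :: "('k, 'm) module \<Rightarrow> nat \<Rightarrow> 'm list set"
  where "tuples M a = {xs. length xs = a \<and> set xs \<subseteq> carrier M}"

definition tensor_rel :: "('k, 'r) ring_scheme \<Rightarrow> ('k, 'm) module \<Rightarrow> nat \<Rightarrow> ('m list \<Rightarrow> 'k) set"
  where "tensor_rel R M a =
    (let L = free_module R (tuples M a); g = free_gen R in
     {g (xs[i := u \<oplus>\<^bsub>M\<^esub> v]) \<ominus>\<^bsub>L\<^esub> (g (xs[i := u]) \<oplus>\<^bsub>L\<^esub> g (xs[i := v])) | xs i u v.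
        xs \<in> tuples M a \<and> i < a \<and> u \<in> carrier M \<and> v \<in> carrier M} \<union>
     {g (xs[i := c \<odot>\<^bsub>M\<^esub> u]) \<ominus>\<^bsub>L\<^esub> c \<odot>\<^bsub>L\<^esub> g (xs[i := u]) | xs i c u.
        xs \<in> tuples M a \<and> i < a \<and> c \<in> carrier R \<and> u \<in> carrier M})"

definition tensor_ker :: "('k, 'r) ring_scheme \<Rightarrow> ('k, 'm) module \<Rightarrow> nat \<Rightarrow> ('m list \<Rightarrow> 'k) set"
  where "tensor_ker R M a = gen_submodule R (free_module R (tuples M a)) (tensor_rel R M a)"

definition tensor_power ::
    "('k, 'r) ring_scheme \<Rightarrow> ('k, 'm) module \<Rightarrow> nat \<Rightarrow> ('k, ('m list \<Rightarrow> 'k) set) module"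
  where "tensor_power R M a = quot_module (free_module R (tuples M a)) (tensor_ker R M a)"

text \<open>The map \<open>M\<^sup>\<otimes>\<^sup>a \<rightarrow> N\<^sup>\<otimes>\<^sup>a\<close> induced by \<open>h : M \<rightarrow> N\<close>, on cosets of the submodule of relations.\<close>

definition tensor_power_map ::
    "('k, 'r) ring_scheme \<Rightarrow> ('k, 'n) module \<Rightarrow> nat \<Rightarrow> ('m \<Rightarrow> 'n) \<Rightarrow>
     ('m list \<Rightarrow> 'k) set \<Rightarrow> ('n list \<Rightarrow> 'k) set"
  where "tensor_power_map R N a h C =
    (\<Union>\<phi> \<in> C. tensor_ker R N a +>\<^bsub>free_module R (tuples N a)\<^esub> free_map R (map h) \<phi>)"


section \<open>Functors on finite non-empty sets\<close>

text \<open>The finite non-empty sets are those with elements in a type \<open>'x\<close>, which has to be infinite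
  for this to be (a small model of) the category of all finite non-empty sets. The morphisms
  \<open>X \<rightarrow> Y\<close> are the maps \<open>f \<in> X \<rightarrow>\<^sub>E Y\<close>. A functor takes values in modules whose elements
  come from a type \<open>'m\<close>.\<close>

definition fin_sets :: "'x set set"
  where "fin_sets = {X. finite X \<and> X \<noteq> {}}"

record ('x, 'k, 'm) fin_functor =
  ob :: "'x set \<Rightarrow> ('k, 'm) module"
  mor :: "'x set \<Rightarrow> 'x set \<Rightarrow> ('x \<Rightarrow> 'x) \<Rightarrow> 'm \<Rightarrow> 'm"

definition is_functor :: "('k, 'r) ring_scheme \<Rightarrow> ('x, 'k, 'm) fin_functor \<Rightarrow> bool"
  where "is_functor R F \<longleftrightarrow>
    (\<forall>X \<in> fin_sets. module R (ob F X)) \<and>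
    (\<forall>X \<in> fin_sets. \<forall>Y \<in> fin_sets. \<forall>f \<in> X \<rightarrow>\<^sub>E Y. mor F X Y f \<in> mod_hom R (ob F X) (ob F Y)) \<and>
    (\<forall>X \<in> fin_sets. \<forall>v \<in> carrier (ob F X). mor F X X (\<lambda>x \<in> X. x) v = v) \<and>
    (\<forall>X \<in> fin_sets. \<forall>Y \<in> fin_sets. \<forall>Z \<in> fin_sets. \<forall>f \<in> X \<rightarrow>\<^sub>E Y. \<forall>g \<in> Y \<rightarrow>\<^sub>E Z.
       \<forall>v \<in> carrier (ob F X). mor F X Z (compose X g f) v = mor F Y Z g (mor F X Y f v))"

definition nat_trans ::
    "('k, 'r) ring_scheme \<Rightarrow> ('x, 'k, 'm) fin_functor \<Rightarrow> ('x, 'k, 'n) fin_functor \<Rightarrow>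
     ('x set \<Rightarrow> 'm \<Rightarrow> 'n) \<Rightarrow> bool"
  where "nat_trans R F G \<eta> \<longleftrightarrow>
    (\<forall>X \<in> fin_sets. \<eta> X \<in> mod_hom R (ob F X) (ob G X)) \<and>
    (\<forall>X \<in> fin_sets. \<forall>Y \<in> fin_sets. \<forall>f \<in> X \<rightarrow>\<^sub>E Y. \<forall>v \<in> carrier (ob F X).
       \<eta> Y (mor F X Y f v) = mor G X Y f (\<eta> X v))"

text \<open>Equality of natural transformations out of \<open>F\<close>: values outside the carriers are irrelevant.\<close>

definition nat_eq ::
    "('x, 'k, 'm) fin_functor \<Rightarrow> ('x set \<Rightarrow> 'm \<Rightarrow> 'n) \<Rightarrow> ('x set \<Rightarrow> 'm \<Rightarrow> 'n) \<Rightarrow> bool"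
  where "nat_eq F \<eta> \<theta> \<longleftrightarrow> (\<forall>X \<in> fin_sets. \<forall>v \<in> carrier (ob F X). \<eta> X v = \<theta> X v)"

definition epi ::
    "('k, 'r) ring_scheme \<Rightarrow> ('x, 'k, 'm) fin_functor \<Rightarrow> ('x, 'k, 'm) fin_functor \<Rightarrow>
     ('x set \<Rightarrow> 'm \<Rightarrow> 'm) \<Rightarrow> bool"
  where "epi R F G p \<longleftrightarrow> nat_trans R F G p \<and>
    (\<forall>(H :: ('x, 'k, 'm) fin_functor) \<eta> \<theta>.
       is_functor R H \<longrightarrow> nat_trans R G H \<eta> \<longrightarrow> nat_trans R G H \<theta> \<longrightarrow>
       nat_eq F (\<lambda>X. \<eta> X \<circ> p X) (\<lambda>X. \<theta> X \<circ> p X) \<longrightarrow> nat_eq G \<eta> \<theta>)"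

text \<open>Projectivity of a functor \<open>P\<close> in the category of functors with values in modules carried by
  \<open>'m\<close>. HOL cannot quantify over \<open>'m\<close> inside the definition. A lifting problem without solution
  in this category is also one in the category of functors to all modules. Conversely, if \<open>'m\<close>
  can carry a direct sum of representable functors mapping onto \<open>P\<close>, as it can for the tensor
  powers below, then a functor that is projective in this sense is projective among all
  functors.\<close>

definition projective :: "('k, 'r) ring_scheme \<Rightarrow> ('x, 'k, 'm) fin_functor \<Rightarrow> bool"
  where "projective R P \<longleftrightarrow>
    (\<forall>(F :: ('x, 'k, 'm) fin_functor) (G :: ('x, 'k, 'm) fin_functor) p \<eta>.
       is_functor R F \<longrightarrow> is_functor R G \<longrightarrow> epi R F G p \<longrightarrow> nat_trans R P G \<eta> \<longrightarrow>
       (\<exists>\<theta>. nat_trans R P F \<theta> \<and> nat_eq P (\<lambda>X. p X \<circ> \<theta> X) \<eta>))"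

definition aug_ker_functor :: "('k, 'r) ring_scheme \<Rightarrow> ('x, 'k, 'x \<Rightarrow> 'k) fin_functor"
  where "aug_ker_functor R =
    \<lparr>ob = (\<lambda>X. (free_module R X)
              \<lparr>carrier := {\<phi> \<in> carrier (free_module R X). augmentation R \<phi> = \<zero>\<^bsub>R\<^esub>}\<rparr>),
     mor = (\<lambda>X Y f. free_map R f)\<rparr>"

definition tensor_power_functor ::
    "('k, 'r) ring_scheme \<Rightarrow> ('x, 'k, 'm) fin_functor \<Rightarrow> nat \<Rightarrow>
     ('x, 'k, ('m list \<Rightarrow> 'k) set) fin_functor"
  where "tensor_power_functor R F a =
    \<lparr>ob = (\<lambda>X. tensor_power R (ob F X) a),
     mor = (\<lambda>X Y f. tensor_power_map R (ob F Y) a (mor F X Y f))\<rparr>"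


section \<open>The tensor powers are functors\<close>

lemma free_simps [simp]:
  "(\<phi> \<in> carrier (free_module R S)) \<longleftrightarrow>
     (\<forall>s. \<phi> s \<in> carrier R) \<and> (\<forall>s. s \<notin> S \<longrightarrow> \<phi> s = \<zero>\<^bsub>R\<^esub>) \<and> finite {s. \<phi> s \<noteq> \<zero>\<^bsub>R\<^esub>}"
  "\<zero>\<^bsub>free_module R S\<^esub> = (\<lambda>s. \<zero>\<^bsub>R\<^esub>)"
  "\<phi> \<oplus>\<^bsub>free_module R S\<^esub> \<psi> = (\<lambda>s. \<phi> s \<oplus>\<^bsub>R\<^esub> \<psi> s)"
  "c \<odot>\<^bsub>free_module R S\<^esub> \<phi> = (\<lambda>s. c \<otimes>\<^bsub>R\<^esub> \<phi> s)"
  by (simp_all add: free_module_def)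

context cring
begin

lemma module_free: "module R (free_module R S)"
proof (rule moduleI)
  show "abelian_group (free_module R S)"
  proof (rule abelian_groupI)
    fix x y assume "x \<in> carrier (free_module R S)" "y \<in> carrier (free_module R S)"
    then show "x \<oplus>\<^bsub>free_module R S\<^esub> y \<in> carrier (free_module R S)"
      by (auto intro: finite_subset[of _ "{s. x s \<noteq> \<zero>} \<union> {s. y s \<noteq> \<zero>}"])
  next
    fix x assume x: "x \<in> carrier (free_module R S)"
    show "\<exists>y\<in>carrier (free_module R S). y \<oplus>\<^bsub>free_module R S\<^esub> x = \<zero>\<^bsub>free_module R S\<^esub>"
      by (rule bexI[of _ "\<lambda>s. \<ominus> x s"])
        (use x in \<open>auto simp: l_neg intro: finite_subset[of _ "{s. x s \<noteq> \<zero>}"]\<close>)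
  qed (auto simp: a_ac)
next
  fix c x assume c: "c \<in> carrier R" and x: "x \<in> carrier (free_module R S)"
  then show "c \<odot>\<^bsub>free_module R S\<^esub> x \<in> carrier (free_module R S)"
    by (auto intro: finite_subset[of _ "{s. x s \<noteq> \<zero>}"])
qed (auto simp: cring_axioms l_distr r_distr m_assoc)

lemma free_map_eq:
  assumes "\<phi> \<in> carrier (free_module R S)" "finite B" "\<And>s. \<phi> s \<noteq> \<zero> \<Longrightarrow> s \<in> B"
  shows "free_map R f \<phi> t = (\<Oplus>s \<in> B. if f s = t then \<phi> s else \<zero>)"
  unfolding free_map_def
  by (rule add.finprod_mono_neutral_cong_left) (use assms in auto)

lemma free_map_add:
  assumes "\<phi> \<in> carrier (free_module R S)" "\<psi> \<in> carrier (free_module R S)"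
  shows "free_map R f (\<lambda>s. \<phi> s \<oplus> \<psi> s) = (\<lambda>t. free_map R f \<phi> t \<oplus> free_map R f \<psi> t)"
proof
  fix t
  let ?B = "{s. \<phi> s \<noteq> \<zero>} \<union> {s. \<psi> s \<noteq> \<zero>}"
  interpret F: module R "free_module R S" by (rule module_free)
  have B: "finite ?B" using assms by simp
  have s: "(\<lambda>s. \<phi> s \<oplus> \<psi> s) \<in> carrier (free_module R S)"
    using F.a_closed[OF assms] by simp
  have "free_map R f (\<lambda>s. \<phi> s \<oplus> \<psi> s) t =
      (\<Oplus>s \<in> ?B. (if f s = t then \<phi> s else \<zero>) \<oplus> (if f s = t then \<psi> s else \<zero>))"
    by (subst free_map_eq[OF s B], use assms in force, intro finsum_cong')
      (use assms in \<open>auto split: if_splits\<close>)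
  also have "\<dots> = (\<Oplus>s \<in> ?B. if f s = t then \<phi> s else \<zero>) \<oplus> (\<Oplus>s \<in> ?B. if f s = t then \<psi> s else \<zero>)"
    by (rule finsum_addf) (use assms in auto)
  also have "\<dots> = free_map R f \<phi> t \<oplus> free_map R f \<psi> t"
    by (subst (1 2) free_map_eq[OF _ B]) (use assms in auto)
  finally show "free_map R f (\<lambda>s. \<phi> s \<oplus> \<psi> s) t = free_map R f \<phi> t \<oplus> free_map R f \<psi> t" .
qed

lemma free_map_smult:
  assumes "\<phi> \<in> carrier (free_module R S)" "c \<in> carrier R"
  shows "free_map R f (\<lambda>s. c \<otimes> \<phi> s) = (\<lambda>t. c \<otimes> free_map R f \<phi> t)"
proof
  fix t
  let ?B = "{s. \<phi> s \<noteq> \<zero>}"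
  interpret F: module R "free_module R S" by (rule module_free)
  have B: "finite ?B" using assms by simp
  have s: "(\<lambda>s. c \<otimes> \<phi> s) \<in> carrier (free_module R S)"
    using F.smult_closed[OF assms(2,1)] by simp
  have "free_map R f (\<lambda>s. c \<otimes> \<phi> s) t = (\<Oplus>s \<in> ?B. c \<otimes> (if f s = t then \<phi> s else \<zero>))"
    by (subst free_map_eq[OF s B]) (use assms in \<open>auto intro!: finsum_cong' split: if_splits\<close>)
  also have "\<dots> = c \<otimes> (\<Oplus>s \<in> ?B. if f s = t then \<phi> s else \<zero>)"
    by (rule finsum_rdistr[symmetric]) (use assms in auto)
  also have "\<dots> = c \<otimes> free_map R f \<phi> t"
    by (subst (1) free_map_eq[OF _ B]) (use assms in auto)
  finally show "free_map R f (\<lambda>s. c \<otimes> \<phi> s) t = c \<otimes> free_map R f \<phi> t" .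
qed

lemma free_map_supp:
  assumes "\<phi> \<in> carrier (free_module R S)" "free_map R f \<phi> t \<noteq> \<zero>"
  shows "\<exists>s. \<phi> s \<noteq> \<zero> \<and> f s = t"
proof (rule ccontr)
  assume "\<not> ?thesis"
  then have "{s. \<phi> s \<noteq> \<zero> \<and> f s = t} = {}" by auto
  then show False using assms(2) unfolding free_map_def by (simp only: finsum_empty simp_thms)
qed

lemma free_map_closed:
  assumes \<phi>: "\<phi> \<in> carrier (free_module R S)" and f: "f \<in> S \<rightarrow> T"
  shows "free_map R f \<phi> \<in> carrier (free_module R T)"
proof -
  have "free_map R f \<phi> t \<in> carrier R" for t
    unfolding free_map_def by (rule finsum_closed) (use \<phi> in auto)
  moreover have "finite {t. free_map R f \<phi> t \<noteq> \<zero>}"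
    by (rule finite_subset[of _ "f ` {s. \<phi> s \<noteq> \<zero>}"]) (use free_map_supp[OF \<phi>] \<phi> in fastforce)+
  moreover have "t \<notin> T \<Longrightarrow> free_map R f \<phi> t = \<zero>" for t
    using free_map_supp[OF \<phi>, of f t] f \<phi> by auto
  ultimately show ?thesis by simp
qed

lemma free_map_hom: "f \<in> S \<rightarrow> T \<Longrightarrow> free_map R f \<in> mod_hom R (free_module R S) (free_module R T)"
  unfolding mod_hom_def using free_map_closed free_map_add free_map_smult
  by (auto simp del: free_simps(1) simp: Pi_def)

lemma free_map_id:
  assumes \<phi>: "\<phi> \<in> carrier (free_module R S)" and f: "\<And>s. s \<in> S \<Longrightarrow> f s = s"
  shows "free_map R f \<phi> = \<phi>"
proof
  fix t
  have "{s. \<phi> s \<noteq> \<zero> \<and> f s = t} = (if \<phi> t \<noteq> \<zero> then {t} else {})"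
    using \<phi> f by auto metis+
  then show "free_map R f \<phi> t = \<phi> t"
    unfolding free_map_def using \<phi> by auto
qed

lemma free_map_cong:
  assumes \<phi>: "\<phi> \<in> carrier (free_module R S)" and f: "\<And>s. s \<in> S \<Longrightarrow> f s = g s"
  shows "free_map R f \<phi> = free_map R g \<phi>"
proof -
  have "{s. \<phi> s \<noteq> \<zero> \<and> f s = t} = {s. \<phi> s \<noteq> \<zero> \<and> g s = t}" for t
    using \<phi> f by auto metis+
  then show ?thesis unfolding free_map_def by simp
qed

lemma free_map_comp:
  assumes \<phi>: "\<phi> \<in> carrier (free_module R S)"
  shows "free_map R (\<lambda>s. g (f s)) \<phi> = free_map R g (free_map R f \<phi>)"
proof
  fix t
  let ?B = "{s. \<phi> s \<noteq> \<zero>}" and ?A = "\<lambda>u. {s. \<phi> s \<noteq> \<zero> \<and> f s = u}"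
  let ?I = "{u \<in> f ` ?B. g u = t}"
  have B: "finite ?B" using \<phi> by simp
  have \<psi>: "free_map R f \<phi> \<in> carrier (free_module R UNIV)"
    by (rule free_map_closed[OF \<phi>]) simp
  have "free_map R g (free_map R f \<phi>) t = (\<Oplus>u \<in> ?I. free_map R f \<phi> u)"
    unfolding free_map_def[of R g]
    by (rule add.finprod_mono_neutral_cong_left)
      (use B free_map_supp[OF \<phi>] \<psi> in fastforce)+
  also have "\<dots> = (\<Oplus>u \<in> ?I. \<Oplus>s \<in> ?A u. \<phi> s)"
    unfolding free_map_def ..
  also have "\<dots> = (\<Oplus>s \<in> \<Union>(?A ` ?I). \<phi> s)"
    by (rule add.finprod_UN_disjoint[symmetric])
      (use B \<phi> in \<open>auto simp: pairwise_def disjnt_def intro: finite_subset[OF _ B]\<close>)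
  also have "\<Union>(?A ` ?I) = {s. \<phi> s \<noteq> \<zero> \<and> g (f s) = t}" by auto
  finally show "free_map R (\<lambda>s. g (f s)) \<phi> t = free_map R g (free_map R f \<phi>) t"
    unfolding free_map_def by simp
qed

lemma free_gen_closed: "s \<in> S \<Longrightarrow> free_gen R s \<in> carrier (free_module R S)"
  by (auto simp: free_gen_def intro: finite_subset[of _ "{s}"])

lemma free_map_gen: "free_map R f (free_gen R s) = free_gen R (f s)"
proof
  fix t
  have "free_map R f (free_gen R s) t = (\<Oplus>u \<in> {s}. if f u = t then free_gen R s u else \<zero>)"
    by (rule free_map_eq[of _ UNIV])
      (use free_gen_closed[of s UNIV] in \<open>auto simp: free_gen_def split: if_splits\<close>)
  then show "free_map R f (free_gen R s) t = free_gen R (f s) t"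
    by (auto simp: free_gen_def)
qed

lemma augmentation_eq: "augmentation R \<phi> = free_map R (\<lambda>_. ()) \<phi> ()"
  by (simp add: augmentation_def free_map_def)

end

lemma gen_submodule_is_submodule:
  assumes "module R M" "A \<subseteq> carrier M"
  shows "submodule (gen_submodule R M A) R M"
proof -
  interpret module R M by fact
  note E = submoduleE
  have z: "\<zero>\<^bsub>M\<^esub> \<in> H" if "submodule H R M" for H
    using subgroup.one_closed[OF submodule.axioms(1)[OF that]] by simp
  show ?thesis
  proof (rule submoduleI)
    show "gen_submodule R M A \<subseteq> carrier M"
      unfolding gen_submodule_def using carrier_is_submodule assms by auto
  qed (use E(3,4,5) z in \<open>auto simp: gen_submodule_def\<close>)
qed

lemma gen_submodule_incl: "A \<subseteq> gen_submodule R M A"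
  by (auto simp: gen_submodule_def)

locale quot_mod = module R M for R :: "('k, 'r) ring_scheme" and M :: "('k, 'm) module" + fixes H
  assumes sub: "submodule H R M"
begin

sublocale abelian_subgroup H M
  by (rule abelian_subgroupI3)
    (use sub in \<open>auto simp: additive_subgroup_def submodule_def abelian_group_axioms\<close>)

lemma coset_eq_iff:
  assumes "u \<in> carrier M" "v \<in> carrier M"
  shows "H +>\<^bsub>M\<^esub> u = H +>\<^bsub>M\<^esub> v \<longleftrightarrow> u \<oplus>\<^bsub>M\<^esub> \<ominus>\<^bsub>M\<^esub> v \<in> H"
  using assms a_rcos_module a_repr_independence' a_repr_independenceD by metis

lemma quot_carrier: "carrier (quot_module M H) = (\<lambda>v. H +>\<^bsub>M\<^esub> v) ` carrier M"
  by (auto simp: quot_module_def A_RCOSETS_def')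

lemma quot_add:
  "u \<in> carrier M \<Longrightarrow> v \<in> carrier M \<Longrightarrow>
   (H +>\<^bsub>M\<^esub> u) \<oplus>\<^bsub>quot_module M H\<^esub> (H +>\<^bsub>M\<^esub> v) = H +>\<^bsub>M\<^esub> (u \<oplus>\<^bsub>M\<^esub> v)"
  by (simp add: quot_module_def a_rcos_sum)

lemma UN_coset:
  assumes u: "u \<in> carrier M" and "\<And>v. v \<in> H +>\<^bsub>M\<^esub> u \<Longrightarrow> f v = f u"
  shows "(\<Union>v \<in> H +>\<^bsub>M\<^esub> u. f v) = f u"
  using a_rcos_self[OF u] assms(2) by blast

lemma quot_smult:
  assumes "c \<in> carrier R" "u \<in> carrier M"
  shows "c \<odot>\<^bsub>quot_module M H\<^esub> (H +>\<^bsub>M\<^esub> u) = H +>\<^bsub>M\<^esub> (c \<odot>\<^bsub>M\<^esub> u)"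
proof -
  have "H +>\<^bsub>M\<^esub> (c \<odot>\<^bsub>M\<^esub> v) = H +>\<^bsub>M\<^esub> (c \<odot>\<^bsub>M\<^esub> u)" if "v \<in> H +>\<^bsub>M\<^esub> u" for v
  proof -
    have v: "v \<in> carrier M" using that assms a_elemrcos_carrier by blast
    have "v \<oplus>\<^bsub>M\<^esub> \<ominus>\<^bsub>M\<^esub> u \<in> H" using a_rcos_module_imp that assms by blast
    then have "c \<odot>\<^bsub>M\<^esub> (v \<oplus>\<^bsub>M\<^esub> \<ominus>\<^bsub>M\<^esub> u) \<in> H" using submodule.smult_closed[OF sub] assms by blast
    then show ?thesis using assms v by (simp add: coset_eq_iff smult_r_distr smult_r_minus)
  qed
  then have "(\<Union>v \<in> H +>\<^bsub>M\<^esub> u. H +>\<^bsub>M\<^esub> (c \<odot>\<^bsub>M\<^esub> v)) = H +>\<^bsub>M\<^esub> (c \<odot>\<^bsub>M\<^esub> u)"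
    by (rule UN_coset[OF assms(2)])
  then show ?thesis by (simp add: quot_module_def)
qed

lemma module_quot: "module R (quot_module M H)"
proof (rule moduleI)
  show "cring R" by (rule R.cring_axioms)
  have z: "\<zero>\<^bsub>quot_module M H\<^esub> = H +>\<^bsub>M\<^esub> \<zero>\<^bsub>M\<^esub>"
    using a_rcos_const[of "\<zero>\<^bsub>M\<^esub>"] zero_closed by (simp add: quot_module_def)
  show "abelian_group (quot_module M H)"
  proof (rule abelian_groupI)
    fix x assume "x \<in> carrier (quot_module M H)"
    then obtain u where "u \<in> carrier M" "x = H +>\<^bsub>M\<^esub> u" by (auto simp: quot_carrier)
    then show "\<exists>y\<in>carrier (quot_module M H). y \<oplus>\<^bsub>quot_module M H\<^esub> x = \<zero>\<^bsub>quot_module M H\<^esub>"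
      by (intro bexI[of _ "H +>\<^bsub>M\<^esub> (\<ominus>\<^bsub>M\<^esub> u)"]) (auto simp: quot_carrier quot_add z M.l_neg)
  qed (auto simp: quot_carrier quot_add z M.a_ac)
qed (auto simp: quot_carrier quot_add quot_smult smult_l_distr smult_r_distr smult_assoc1)

end

lemma tensor_rel_subset:
  assumes "module R M"
  shows "tensor_rel R M a \<subseteq> carrier (free_module R (tuples M a))"
proof -
  interpret M: module R M by fact
  interpret L: module R "free_module R (tuples M a)" by (rule M.module_free)
  have t: "xs[i := u] \<in> tuples M a" if "xs \<in> tuples M a" "u \<in> carrier M" for xs i u
    using that set_update_subset_insert[of xs i u] unfolding tuples_def by fastforce
  show ?thesis
    unfolding tensor_rel_def Let_def
    by (intro Un_least subsetI; elim CollectE exE conjE; hypsubst)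
      (intro L.minus_closed L.a_closed L.smult_closed M.free_gen_closed t M.M.a_closed M.smult_closed; assumption)+
qed

lemma tensor_quot: "module R M \<Longrightarrow> quot_mod R (free_module R (tuples M a)) (tensor_ker R M a)"
  unfolding tensor_ker_def
  by (intro quot_mod.intro quot_mod_axioms.intro gen_submodule_is_submodule
      tensor_rel_subset cring.module_free module.axioms(1))

lemma mod_homD:
  assumes "h \<in> mod_hom R M N"
  shows "u \<in> carrier M \<Longrightarrow> h u \<in> carrier N"
    "u \<in> carrier M \<Longrightarrow> v \<in> carrier M \<Longrightarrow> h (u \<oplus>\<^bsub>M\<^esub> v) = h u \<oplus>\<^bsub>N\<^esub> h v"
    "c \<in> carrier R \<Longrightarrow> v \<in> carrier M \<Longrightarrow> h (c \<odot>\<^bsub>M\<^esub> v) = c \<odot>\<^bsub>N\<^esub> h v"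
  using assms by (auto simp: mod_hom_def)

lemma mod_hom_minus:
  assumes "module R M" "module R N" "h \<in> mod_hom R M N" "u \<in> carrier M" 
  shows "h (\<ominus>\<^bsub>M\<^esub> u) = \<ominus>\<^bsub>N\<^esub> h u"
proof -
  interpret M: module R M by fact
  interpret N: module R N by fact
  note h = mod_homD[OF assms(3)]
  have "h (\<ominus>\<^bsub>M\<^esub> u) = h ((\<ominus>\<^bsub>R\<^esub> \<one>\<^bsub>R\<^esub>) \<odot>\<^bsub>M\<^esub> u)" using assms(4) M.smult_l_minus by simp
  also have "\<dots> = \<ominus>\<^bsub>N\<^esub> h u" using assms(4) h N.smult_l_minus by simp
  finally show ?thesis .
qed

lemma preimage_submodule:
  assumes "module R M" "module R N" "h \<in> mod_hom R M N" "submodule K R N"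
  shows "submodule {u \<in> carrier M. h u \<in> K} R M"
proof -
  interpret M: module R M by fact
  interpret N: module R N by fact
  note h = mod_homD[OF assms(3)]
  note K = N.submoduleE[OF assms(4)]
  have "\<zero>\<^bsub>N\<^esub> \<in> K" using assms(4) subgroup.one_closed submodule.axioms(1) by fastforce
  moreover have "h \<zero>\<^bsub>M\<^esub> = \<zero>\<^bsub>N\<^esub>"
    using h(1)[of "\<zero>\<^bsub>M\<^esub>"] h(3)[of "\<zero>\<^bsub>R\<^esub>" "\<zero>\<^bsub>M\<^esub>"] by simp
  ultimately show ?thesis
    by (intro M.submoduleI) (auto simp: h K mod_hom_minus[OF assms(1-3)])
qed

lemma map_tuples: "h \<in> mod_hom R M N \<Longrightarrow> map h \<in> tuples M a \<rightarrow> tuples N a"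
  by (fastforce simp: tuples_def mod_hom_def)

lemma tensor_map_ker:
  assumes "module R M" "module R N" and h: "h \<in> mod_hom R M N" and \<phi>: "\<phi> \<in> tensor_ker R M a"
  shows "free_map R (map h) \<phi> \<in> tensor_ker R N a"
proof -
  interpret M: module R M by fact
  interpret N: module R N by fact
  let ?L = "free_module R (tuples M a)" and ?K = "free_module R (tuples N a)"
  let ?f = "free_map R (map h)"
  interpret L: module R ?L by (rule M.module_free)
  interpret K: module R ?K by (rule M.module_free)
  interpret Q: quot_mod R ?K "tensor_ker R N a" by (rule tensor_quot) fact
  have mt: "map h \<in> tuples M a \<rightarrow> tuples N a" by (rule map_tuples[OF h])
  have f: "?f \<in> mod_hom R ?L ?K" by (rule M.free_map_hom[OF mt])
  note fD = mod_homD[OF f] and fm = mod_hom_minus[OF L.module_axioms K.module_axioms f]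
    and hD = mod_homD[OF h]
  have t: "xs[i := u] \<in> tuples M a" if "xs \<in> tuples M a" "u \<in> carrier M" for xs i u
    using that set_update_subset_insert[of xs i u] unfolding tuples_def by fastforce
  have mtt: "map h xs \<in> tuples N a" if "xs \<in> tuples M a" for xs using that mt by auto
  have "?f \<psi> \<in> tensor_rel R N a" if "\<psi> \<in> tensor_rel R M a" for \<psi>
    using that unfolding tensor_rel_def Let_def
  proof (elim UnE CollectE exE conjE)
    fix xs i u v
    assume "\<psi> = free_gen R (xs[i := u \<oplus>\<^bsub>M\<^esub> v]) \<ominus>\<^bsub>?L\<^esub> (free_gen R (xs[i := u]) \<oplus>\<^bsub>?L\<^esub> free_gen R (xs[i := v]))"
      and a: "xs \<in> tuples M a" "i < a" "u \<in> carrier M" "v \<in> carrier M"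
    then have "?f \<psi> = free_gen R ((map h xs)[i := h u \<oplus>\<^bsub>N\<^esub> h v]) \<ominus>\<^bsub>?K\<^esub> (free_gen R ((map h xs)[i := h u]) \<oplus>\<^bsub>?K\<^esub> free_gen R ((map h xs)[i := h v]))"
      by (simp add: a_minus_def fD fm t M.free_gen_closed M.free_map_gen map_update hD del: free_simps)
    with a mtt hD show "?f \<psi> \<in> {free_gen R (xs[i := u \<oplus>\<^bsub>N\<^esub> v]) \<ominus>\<^bsub>?K\<^esub> (free_gen R (xs[i := u]) \<oplus>\<^bsub>?K\<^esub> free_gen R (xs[i := v])) | xs i u v.
        xs \<in> tuples N a \<and> i < a \<and> u \<in> carrier N \<and> v \<in> carrier N} \<union>
     {free_gen R (xs[i := c \<odot>\<^bsub>N\<^esub> u]) \<ominus>\<^bsub>?K\<^esub> c \<odot>\<^bsub>?K\<^esub> free_gen R (xs[i := u]) | xs i c u.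
        xs \<in> tuples N a \<and> i < a \<and> c \<in> carrier R \<and> u \<in> carrier N}" by blast
  next
    fix xs i c u
    assume "\<psi> = free_gen R (xs[i := c \<odot>\<^bsub>M\<^esub> u]) \<ominus>\<^bsub>?L\<^esub> c \<odot>\<^bsub>?L\<^esub> free_gen R (xs[i := u])"
      and a: "xs \<in> tuples M a" "i < a" "c \<in> carrier R" "u \<in> carrier M"
    then have "?f \<psi> = free_gen R ((map h xs)[i := c \<odot>\<^bsub>N\<^esub> h u]) \<ominus>\<^bsub>?K\<^esub> c \<odot>\<^bsub>?K\<^esub> free_gen R ((map h xs)[i := h u])"
      by (simp add: a_minus_def fD fm t M.free_gen_closed M.free_map_gen map_update hD del: free_simps)
    with a mtt hD show "?f \<psi> \<in> {free_gen R (xs[i := u \<oplus>\<^bsub>N\<^esub> v]) \<ominus>\<^bsub>?K\<^esub> (free_gen R (xs[i := u]) \<oplus>\<^bsub>?K\<^esub> free_gen R (xs[i := v])) | xs i u v.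
        xs \<in> tuples N a \<and> i < a \<and> u \<in> carrier N \<and> v \<in> carrier N} \<union>
     {free_gen R (xs[i := c \<odot>\<^bsub>N\<^esub> u]) \<ominus>\<^bsub>?K\<^esub> c \<odot>\<^bsub>?K\<^esub> free_gen R (xs[i := u]) | xs i c u.
        xs \<in> tuples N a \<and> i < a \<and> c \<in> carrier R \<and> u \<in> carrier N}" by blast
  qed
  then have "tensor_rel R M a \<subseteq> {\<psi> \<in> carrier ?L. ?f \<psi> \<in> tensor_ker R N a}"
    using tensor_rel_subset[OF assms(1), of a] gen_submodule_incl[of "tensor_rel R N a" R ?K]
    unfolding tensor_ker_def by blast
  moreover have "submodule {\<psi> \<in> carrier ?L. ?f \<psi> \<in> tensor_ker R N a} R ?L"
    by (rule preimage_submodule[OF L.module_axioms K.module_axioms f Q.sub])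
  ultimately show ?thesis using \<phi> unfolding tensor_ker_def gen_submodule_def by auto
qed

lemma tensor_map_coset:
  assumes "module R M" "module R N" and h: "h \<in> mod_hom R M N"
    and \<phi>: "\<phi> \<in> carrier (free_module R (tuples M a))"
  shows "tensor_power_map R N a h (tensor_ker R M a +>\<^bsub>free_module R (tuples M a)\<^esub> \<phi>) =
    tensor_ker R N a +>\<^bsub>free_module R (tuples N a)\<^esub> free_map R (map h) \<phi>"
proof -
  interpret M: module R M by fact
  let ?L = "free_module R (tuples M a)" and ?K = "free_module R (tuples N a)"
  interpret L: quot_mod R ?L "tensor_ker R M a" by (rule tensor_quot) fact
  interpret K: quot_mod R ?K "tensor_ker R N a" by (rule tensor_quot) fact
  have mt: "map h \<in> tuples M a \<rightarrow> tuples N a" by (rule map_tuples[OF h])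
  have f: "free_map R (map h) \<in> mod_hom R ?L ?K" by (rule M.free_map_hom[OF mt])
  note fD = mod_homD[OF f] and fm = mod_hom_minus[OF L.module_axioms K.module_axioms f]
  show ?thesis unfolding tensor_power_map_def
  proof (rule L.UN_coset[OF \<phi>])
    fix \<psi> assume c: "\<psi> \<in> tensor_ker R M a +>\<^bsub>?L\<^esub> \<phi>"
    then have \<psi>: "\<psi> \<in> carrier ?L" using L.a_elemrcos_carrier \<phi> by blast
    have "free_map R (map h) (\<psi> \<oplus>\<^bsub>?L\<^esub> \<ominus>\<^bsub>?L\<^esub> \<phi>) \<in> tensor_ker R N a"
      by (rule tensor_map_ker[OF assms(1-3)]) (use L.a_rcos_module_imp c \<phi> in blast)
    then show "tensor_ker R N a +>\<^bsub>?K\<^esub> free_map R (map h) \<psi> = tensor_ker R N a +>\<^bsub>?K\<^esub> free_map R (map h) \<phi>"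
      by (subst K.coset_eq_iff) (use fD fm \<psi> \<phi> in \<open>simp_all del: free_simps\<close>)
  qed
qed

theorem is_functor_tensor_power:
  assumes F: "is_functor R F"
  shows "is_functor R (tensor_power_functor R F a)"
proof -
  have m: "module R (ob F X)" if "X \<in> fin_sets" for X
    using F that by (auto simp: is_functor_def)
  have h: "mor F X Y f \<in> mod_hom R (ob F X) (ob F Y)" if "X \<in> fin_sets" "Y \<in> fin_sets" "f \<in> X \<rightarrow>\<^sub>E Y" for X Y f
    using F that by (auto simp: is_functor_def)
  have i: "mor F X X (\<lambda>x \<in> X. x) v = v" if "X \<in> fin_sets" "v \<in> carrier (ob F X)" for X v
    using F that by (auto simp: is_functor_def)
  have c: "mor F X Z (compose X g f) v = mor F Y Z g (mor F X Y f v)"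
    if "X \<in> fin_sets" "Y \<in> fin_sets" "Z \<in> fin_sets" "f \<in> X \<rightarrow>\<^sub>E Y" "g \<in> Y \<rightarrow>\<^sub>E Z" "v \<in> carrier (ob F X)" for X Y Z f g v
    using F that unfolding is_functor_def by blast
  have idE: "(\<lambda>x \<in> X. x) \<in> X \<rightarrow>\<^sub>E X" for X :: "'c set" by auto
  have cE: "compose X g f \<in> X \<rightarrow>\<^sub>E Z" if "f \<in> X \<rightarrow>\<^sub>E Y" "g \<in> Y \<rightarrow>\<^sub>E Z" for X Y Z :: "'c set" and f g
    using that by (auto simp: compose_def)
  let ?L = "\<lambda>X. free_module R (tuples (ob F X) a)" and ?K = "\<lambda>X. tensor_ker R (ob F X) a"
  have q: "quot_mod R (?L X) (?K X)" if "X \<in> fin_sets" for X by (rule tensor_quot[OF m[OF that]])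
  have mt: "map (mor F X Y f) \<in> tuples (ob F X) a \<rightarrow> tuples (ob F Y) a"
    if "X \<in> fin_sets" "Y \<in> fin_sets" "f \<in> X \<rightarrow>\<^sub>E Y" for X Y f
    by (rule map_tuples[OF h[OF that]])
  have R: "cring R" if "X \<in> fin_sets" for X :: "'c set" using m[OF that] module.axioms(1) by blast
  have fh: "free_map R (map (mor F X Y f)) \<in> mod_hom R (?L X) (?L Y)"
    if "X \<in> fin_sets" "Y \<in> fin_sets" "f \<in> X \<rightarrow>\<^sub>E Y" for X Y f
    by (rule cring.free_map_hom[OF R mt]) fact+
  note simps = tensor_power_functor_def tensor_power_def
  show ?thesis unfolding is_functor_def
  proof (intro conjI ballI)
    fix X :: "'c set" assume X: "X \<in> fin_sets"
    show "module R (ob (tensor_power_functor R F a) X)"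
      using quot_mod.module_quot[OF q[OF X]] by (simp add: simps)
  next
    fix X Y :: "'c set" and f assume X: "X \<in> fin_sets" and Y: "Y \<in> fin_sets" and f: "f \<in> X \<rightarrow>\<^sub>E Y"
    interpret L: quot_mod R "?L X" "?K X" by (rule q[OF X])
    interpret K: quot_mod R "?L Y" "?K Y" by (rule q[OF Y])
    note fD = mod_homD[OF fh[OF X Y f]]
    note tc = tensor_map_coset[OF m[OF X] m[OF Y] h[OF X Y f]]
    show "mor (tensor_power_functor R F a) X Y f
       \<in> mod_hom R (ob (tensor_power_functor R F a) X) (ob (tensor_power_functor R F a) Y)"
      unfolding mod_hom_def
      by (auto simp: simps L.quot_carrier K.quot_carrier L.quot_add K.quot_add L.quot_smult
          K.quot_smult tc fD simp del: free_simps)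
  next
    fix X :: "'c set" and v assume X: "X \<in> fin_sets" and v: "v \<in> carrier (ob (tensor_power_functor R F a) X)"
    interpret L: quot_mod R "?L X" "?K X" by (rule q[OF X])
    obtain \<phi> where \<phi>: "\<phi> \<in> carrier (?L X)" "v = ?K X +>\<^bsub>?L X\<^esub> \<phi>"
      using v by (auto simp: simps L.quot_carrier simp del: free_simps)
    have "free_map R (map (mor F X X (\<lambda>x\<in>X. x))) \<phi> = \<phi>"
      by (rule cring.free_map_id[OF R[OF X] \<phi>(1)]) (auto simp: tuples_def subset_iff i[OF X] intro: map_idI)
    then show "mor (tensor_power_functor R F a) X X (\<lambda>x\<in>X. x) v = v"
      using tensor_map_coset[OF m[OF X] m[OF X] h[OF X X idE] \<phi>(1)] \<phi>(2) by (simp add: simps)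
  next
    fix X Y Z :: "'c set" and f g v
    assume X: "X \<in> fin_sets" and Y: "Y \<in> fin_sets" and Z: "Z \<in> fin_sets"
      and f: "f \<in> X \<rightarrow>\<^sub>E Y" and g: "g \<in> Y \<rightarrow>\<^sub>E Z"
      and v: "v \<in> carrier (ob (tensor_power_functor R F a) X)"
    interpret L: quot_mod R "?L X" "?K X" by (rule q[OF X])
    obtain \<phi> where \<phi>: "\<phi> \<in> carrier (?L X)" "v = ?K X +>\<^bsub>?L X\<^esub> \<phi>"
      using v by (auto simp: simps L.quot_carrier simp del: free_simps)
    have "free_map R (map (mor F X Z (compose X g f))) \<phi> =
        free_map R (\<lambda>xs. map (mor F Y Z g) (map (mor F X Y f) xs)) \<phi>"
      by (rule cring.free_map_cong[OF R[OF X] \<phi>(1)])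
        (auto simp: tuples_def subset_iff c[OF X Y Z f g])
    also have "\<dots> = free_map R (map (mor F Y Z g)) (free_map R (map (mor F X Y f)) \<phi>)"
      by (rule cring.free_map_comp[OF R[OF X] \<phi>(1)])
    finally show "mor (tensor_power_functor R F a) X Z (compose X g f) v =
        mor (tensor_power_functor R F a) Y Z g (mor (tensor_power_functor R F a) X Y f v)"
      using tensor_map_coset[OF m[OF X] m[OF Z] h[OF X Z cE[OF f g]] \<phi>(1)]
        tensor_map_coset[OF m[OF X] m[OF Y] h[OF X Y f] \<phi>(1)]
        tensor_map_coset[OF m[OF Y] m[OF Z] h[OF Y Z g] mod_homD(1)[OF fh[OF X Y f] \<phi>(1)]] \<phi>(2)
      by (simp add: simps)
  qed
qed

theorem is_functor_aug_ker:
  fixes R :: "('k, 'r) ring_scheme" (structure)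
  assumes "cring R"
  shows "is_functor R (aug_ker_functor R :: ('x, 'k, 'x \<Rightarrow> 'k) fin_functor)"
proof -
  interpret cring R by fact
  let ?F = "aug_ker_functor R :: ('x, 'k, 'x \<Rightarrow> 'k) fin_functor"
  let ?e = "\<lambda>\<phi> :: 'x \<Rightarrow> 'k. free_map R (\<lambda>_. ()) \<phi>"
  have eh: "?e \<in> mod_hom R (free_module R X) (free_module R UNIV)" for X
    by (rule free_map_hom) simp
  have ker: "{\<phi> \<in> carrier (free_module R X). augmentation R \<phi> = \<zero>} =
      {\<phi> \<in> carrier (free_module R X). ?e \<phi> \<in> {\<lambda>_. \<zero>}}" for X
    by (auto simp: augmentation_eq simp del: free_simps)
  interpret U: module R "free_module R (UNIV :: unit set)" by (rule module_free)
  have z: "submodule {\<lambda>_. \<zero>} R (free_module R (UNIV :: unit set))"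
    using U.r_neg[OF U.zero_closed] U.l_neg[OF U.zero_closed] U.M.l_zero[of "\<ominus>\<^bsub>free_module R UNIV\<^esub> (\<lambda>_. \<zero>)"] U.a_inv_closed[OF U.zero_closed] by (intro U.submoduleI) auto
  have sub: "submodule {\<phi> \<in> carrier (free_module R X). augmentation R \<phi> = \<zero>} R (free_module R X)" for X :: "'x set"
    unfolding ker by (rule preimage_submodule[OF module_free module_free eh z])
  have aug: "augmentation R (free_map R f \<phi>) = augmentation R \<phi>"
    if "\<phi> \<in> carrier (free_module R X)" for f :: "'x \<Rightarrow> 'x" and \<phi> and X :: "'x set"
    using free_map_comp[OF that, of "\<lambda>_. ()" f] by (simp add: augmentation_eq)
  show ?thesis unfolding is_functor_def
  proof (intro conjI ballI)
    fix X :: "'x set"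
    show "module R (ob ?F X)"
      using submodule.submodule_is_module[OF sub module_free] by (simp add: aug_ker_functor_def)
  next
    fix X Y :: "'x set" and f assume f: "f \<in> X \<rightarrow>\<^sub>E Y"
    then have f': "f \<in> X \<rightarrow> Y" by auto
    note fD = mod_homD[OF free_map_hom[OF f']]
    show "mor ?F X Y f \<in> mod_hom R (ob ?F X) (ob ?F Y)"
      unfolding mod_hom_def aug_ker_functor_def using fD aug[of _ X f]
      by (auto simp del: free_simps(1) simp: Pi_def)
  next
    fix X :: "'x set" and v assume "v \<in> carrier (ob ?F X)"
    then show "mor ?F X X (\<lambda>x\<in>X. x) v = v"
      by (auto simp: aug_ker_functor_def simp del: free_simps intro!: free_map_id[of _ X])
  next
    fix X Y Z :: "'x set" and f g v assume v: "v \<in> carrier (ob ?F X)"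
    then have v: "v \<in> carrier (free_module R X)" by (auto simp: aug_ker_functor_def simp del: free_simps)
    show "mor ?F X Z (compose X g f) v = mor ?F Y Z g (mor ?F X Y f v)"
      using free_map_comp[OF v, of g f] free_map_cong[OF v, of "compose X g f" "\<lambda>x. g (f x)"]
      by (simp add: aug_ker_functor_def compose_def)
  qed
qed

declare free_simps [simp del]

end

theory Submission
  imports Defs "HOL-Combinatorics.Permutations"
begin

text \<open>
  Write \<open>T\<close> for the functor \<open>X \<mapsto> ker(k[X] \<rightarrow> k)\<^sup>\<otimes>\<^sup>a\<close> and \<open>W\<close> for the functor of words \<open>X \<mapsto> k[X\<^sup>a\<^sup>+\<^sup>1]\<close>.
  The map \<open>p : W \<rightarrow> T\<close> that sends the word \<open>[x\<^sub>0, \<dots>, x\<^sub>a]\<close> to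
  \<open>([x\<^sub>1] - [x\<^sub>0]) \<otimes> \<dots> \<otimes> ([x\<^sub>a] - [x\<^sub>0])\<close> is an epimorphism (\<open>words_to_tensors_epi\<close>), so if \<open>T\<close>
  were projective, \<open>p\<close> would have a section \<open>s\<close>.

  Let \<open>X\<close> have \<open>a + 1\<close> elements and let \<open>z\<close> be a further point. The differences \<open>[x] - [z]\<close> with \<open>x \<in> X\<close>
  span the augmentation kernel on \<open>X \<union> {z}\<close>, so the tensors of \<open>a\<close> of them span \<open>T(X \<union> {z})\<close>. Such a
  tensor has too few factors to involve every point of \<open>X\<close>; it therefore comes from \<open>T\<close> of the set
  \<open>X \<union> {z} - {x}\<close> for some \<open>x \<in> X\<close>, which is non-empty because it contains \<open>z\<close>. By naturality, every word
  that occurs in a value of \<open>s\<close> at \<open>X \<union> {z}\<close> misses a point of \<open>X\<close>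
  (\<open>nat_trans_supported_on_proper_subsets\<close>). Since \<open>W(X)\<close> embeds into \<open>W(X \<union> {z})\<close>, the same is true of
  the values of \<open>s\<close> at \<open>X\<close>.

  A word of length \<open>a + 1\<close> in fewer than \<open>a + 1\<close> letters repeats a letter, so \<open>p\<close> sends it to a tensor
  with a zero factor (if \<open>x\<^sub>0\<close> is repeated) or with two equal factors. Let
  \<open>X = {y\<^sub>0, \<dots>, y\<^sub>a}\<close>. The multilinear functional
  \<open>v\<^sub>1 \<otimes> \<dots> \<otimes> v\<^sub>a \<mapsto> det (v\<^sub>i(y\<^sub>j))\<close>, with \<open>i\<close> and \<open>j\<close> from \<open>1\<close> to \<open>a\<close>, vanishes on all these tensors, hence
  on \<open>p(s(u))\<close> for every \<open>u\<close>. But it takes the value \<open>1\<close> on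
  \<open>u = ([y\<^sub>1] - [y\<^sub>0]) \<otimes> \<dots> \<otimes> ([y\<^sub>a] - [y\<^sub>0])\<close>, and \<open>p(s(u)) = u\<close>: a contradiction (\<open>no_section\<close>).
  For \<open>a = 0\<close> no word of length \<open>1\<close> repeats a letter, and the argument says that \<open>s(1) = 0\<close>.
\<close>

section \<open>Submodules, equalizers and generators\<close>

lemma (in module) submoduleI_closed:
  assumes "H \<subseteq> carrier M" "\<zero>\<^bsub>M\<^esub> \<in> H"
    and "\<And>u v. u \<in> H \<Longrightarrow> v \<in> H \<Longrightarrow> u \<oplus>\<^bsub>M\<^esub> v \<in> H"
    and smult: "\<And>c u. c \<in> carrier R \<Longrightarrow> u \<in> H \<Longrightarrow> c \<odot>\<^bsub>M\<^esub> u \<in> H"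
  shows "submodule H R M"
proof (rule submoduleI)
  fix u assume u: "u \<in> H"
  with assms(1) have "(\<ominus>\<^bsub>R\<^esub> \<one>\<^bsub>R\<^esub>) \<odot>\<^bsub>M\<^esub> u = \<ominus>\<^bsub>M\<^esub> u" by (auto simp: smult_l_minus)
  with smult[OF _ u, of "\<ominus>\<^bsub>R\<^esub> \<one>\<^bsub>R\<^esub>"] show "\<ominus>\<^bsub>M\<^esub> u \<in> H" by simp
qed (use assms in auto)

lemma (in module) submodule_zero: "submodule H R M \<Longrightarrow> \<zero>\<^bsub>M\<^esub> \<in> H"
  using subgroup.one_closed submodule.axioms(1) by fastforce

lemma mod_hom_zero:
  assumes "module R M" "module R N" "h \<in> mod_hom R M N"
  shows "h \<zero>\<^bsub>M\<^esub> = \<zero>\<^bsub>N\<^esub>"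
proof -
  interpret M: module R M by fact
  interpret N: module R N by fact
  show ?thesis
    using mod_homD(1)[OF assms(3), of "\<zero>\<^bsub>M\<^esub>"] mod_homD(3)[OF assms(3), of "\<zero>\<^bsub>R\<^esub>" "\<zero>\<^bsub>M\<^esub>"] by simp
qed

lemma mod_hom_comp:
  "f \<in> mod_hom R L M \<Longrightarrow> g \<in> mod_hom R M N \<Longrightarrow> (\<lambda>u. g (f u)) \<in> mod_hom R L N"
  by (auto simp: mod_hom_def Pi_def)

text \<open>Two homomorphisms that agree on generators agree everywhere: apply the generation lemmas below to
  this submodule.\<close>

lemma equalizer_submodule:
  assumes "module R M" "module R N" and f: "f \<in> mod_hom R M N" and g: "g \<in> mod_hom R M N"
  shows "submodule {u \<in> carrier M. f u = g u} R M"
proof -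
  interpret M: module R M by fact
  show ?thesis
    using mod_homD[OF f] mod_homD[OF g] mod_hom_zero[OF assms(1,2) f] mod_hom_zero[OF assms(1,2) g]
    by (intro M.submoduleI_closed) auto
qed

lemma mod_hom_kernel_submodule:
  assumes "module R M" "module R N" and h: "h \<in> mod_hom R M N"
  shows "submodule {u \<in> carrier M. h u = \<zero>\<^bsub>N\<^esub>} R M"
proof -
  interpret M: module R M by fact
  interpret N: module R N by fact
  show ?thesis
    using mod_homD[OF h] mod_hom_zero[OF assms] by (intro M.submoduleI_closed) auto
qed

lemma gen_submodule_least: "submodule N R M \<Longrightarrow> B \<subseteq> N \<Longrightarrow> gen_submodule R M B \<subseteq> N"
  by (auto simp: gen_submodule_def)

context cring
begin

lemma free_minus:
  assumes "\<phi> \<in> carrier (free_module R S)"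
  shows "\<ominus>\<^bsub>free_module R S\<^esub> \<phi> = (\<lambda>s. \<ominus> \<phi> s)"
proof -
  interpret F: module R "free_module R S" by (rule module_free)
  have "\<phi> s \<in> carrier R" for s using assms by (simp add: free_simps)
  moreover have "\<ominus>\<^bsub>free_module R S\<^esub> \<phi> = (\<ominus> \<one>) \<odot>\<^bsub>free_module R S\<^esub> \<phi>" using F.smult_l_minus assms by simp
  ultimately show ?thesis by (auto simp: free_simps l_minus)
qed

lemma submodule_free_subset: "T \<subseteq> S \<Longrightarrow> submodule (carrier (free_module R T)) R (free_module R S)"
proof -
  assume TS: "T \<subseteq> S"
  interpret S: module R "free_module R S" by (rule module_free)
  interpret T: module R "free_module R T" by (rule module_free)
  have op: "add (free_module R S) = add (free_module R T)" "smult (free_module R S) = smult (free_module R T)"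
     "zero (free_module R S) = zero (free_module R T)" by (simp_all add: free_module_def)
  show ?thesis
    by (rule S.submoduleI_closed) (use TS in \<open>auto simp: op, auto simp: free_simps\<close>)
qed

lemma free_module_spanned:
  assumes W: "submodule W R (free_module R S)" and gen: "\<And>s. s \<in> S \<Longrightarrow> free_gen R s \<in> W"
  shows "carrier (free_module R S) \<subseteq> W"
proof
  interpret S: module R "free_module R S" by (rule module_free)
  note E = S.submoduleE[OF W]
  have "\<phi> \<in> W" if "finite A" "\<phi> \<in> carrier (free_module R S)" "{s. \<phi> s \<noteq> \<zero>} \<subseteq> A" for A \<phi>
    using that
  proof (induction A arbitrary: \<phi>)
    case empty
    then have "\<phi> = \<zero>\<^bsub>free_module R S\<^esub>" by (auto simp: free_simps)
    then show ?case using S.submodule_zero[OF W] by simp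
  next
    case (insert x A)
    show ?case
    proof (cases "x \<in> S")
      case False
      then have "\<phi> x = \<zero>" using insert.prems by (simp add: free_simps)
      then show ?thesis using insert by blast
    next
      case True
      let ?\<psi> = "\<phi>(x := \<zero>)"
      have c: "\<phi> s \<in> carrier R" for s using insert.prems by (simp add: free_simps)
      have "{s. ?\<psi> s \<noteq> \<zero>} \<subseteq> {s. \<phi> s \<noteq> \<zero>}" by auto
      then have "?\<psi> \<in> carrier (free_module R S)"
        using insert.prems(1) by (auto simp: free_simps elim: rev_finite_subset)
      moreover have "{s. ?\<psi> s \<noteq> \<zero>} \<subseteq> A" using insert.prems(2) by auto
      ultimately have "?\<psi> \<in> W" by (rule insert.IH)
      moreover have "\<phi> = ?\<psi> \<oplus>\<^bsub>free_module R S\<^esub> \<phi> x \<odot>\<^bsub>free_module R S\<^esub> free_gen R x"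
        using c by (auto simp: free_simps free_gen_def)
      ultimately show ?thesis using E(4)[OF c gen[OF True]] E(5) by metis
    qed
  qed
  then show "\<phi> \<in> W" if "\<phi> \<in> carrier (free_module R S)" for \<phi>
    using that by (auto simp: free_simps(1))
qed

end

section \<open>Generators of tensor powers\<close>

lemma tuples_update: "xs \<in> tuples M a \<Longrightarrow> u \<in> carrier M \<Longrightarrow> xs[i := u] \<in> tuples M a"
  using set_update_subset_insert[of xs i u] unfolding tuples_def by fastforce

text \<open>A submodule of the free module on tuples that contains the multilinearity relations need only be
  tested on tuples of generators of \<open>M\<close>: for fixed other entries, the values of one entry for which
  the tuple lies in \<open>W\<close> form a submodule of \<open>M\<close>.\<close>

lemma free_tuples_spanned:
  assumes M: "module R M" and W: "submodule W R (free_module R (tuples M a))"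
    and ker: "tensor_ker R M a \<subseteq> W"
    and B: "B \<subseteq> carrier M" "gen_submodule R M B = carrier M"
    and gen: "\<And>xs. length xs = a \<Longrightarrow> set xs \<subseteq> B \<Longrightarrow> free_gen R xs \<in> W"
  shows "carrier (free_module R (tuples M a)) \<subseteq> W"
proof -
  interpret M: module R M by fact
  let ?L = "free_module R (tuples M a)"
  interpret L: module R ?L by (rule M.module_free)
  note E = L.submoduleE[OF W]
  have g: "free_gen R xs \<in> carrier ?L" if "xs \<in> tuples M a" for xs
    by (rule M.free_gen_closed[OF that])
  have rel: "tensor_rel R M a \<subseteq> W"
    using ker unfolding tensor_ker_def by (rule subset_trans[OF gen_submodule_incl])
  have cancel: "u \<in> W" if "u \<ominus>\<^bsub>?L\<^esub> v \<in> W" "v \<in> W" "u \<in> carrier ?L" for u v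
  proof -
    have "v \<in> carrier ?L" using that E(1) by blast
    then have "u = (u \<ominus>\<^bsub>?L\<^esub> v) \<oplus>\<^bsub>?L\<^esub> v" using that
      by (simp add: a_minus_def L.a_assoc L.l_neg)
    then show ?thesis using E(5)[OF that(1,2)] by simp
  qed
  \<comment> \<open>The first \<open>j\<close> entries are arbitrary, the others are generators; each step frees one more entry.\<close>
  have "\<forall>xs \<in> tuples M a. (\<forall>i. j \<le> i \<and> i < a \<longrightarrow> xs ! i \<in> B) \<longrightarrow> free_gen R xs \<in> W" if "j \<le> a" for j
    using that
  proof (induction j)
    case 0
    show ?case
    proof (intro ballI impI)
      fix xs assume xs: "xs \<in> tuples M a" and "\<forall>i. 0 \<le> i \<and> i < a \<longrightarrow> xs ! i \<in> B"
      then show "free_gen R xs \<in> W" by (intro gen) (auto simp: tuples_def in_set_conv_nth)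
    qed
  next
    case (Suc j)
    then have j: "j < a" by simp
    show ?case
    proof (intro ballI impI)
      fix xs assume xs: "xs \<in> tuples M a" and Bs: "\<forall>i. Suc j \<le> i \<and> i < a \<longrightarrow> xs ! i \<in> B"
      have len: "length xs = a" using xs by (simp add: tuples_def)
      let ?N = "{u \<in> carrier M. free_gen R (xs[j := u]) \<in> W}"
      note gu = g[OF tuples_update[OF xs]]
      have add: "free_gen R (xs[j := u \<oplus>\<^bsub>M\<^esub> v]) \<in> W" if "u \<in> ?N" "v \<in> ?N" for u v
      proof (rule cancel)
        show "free_gen R (xs[j := u \<oplus>\<^bsub>M\<^esub> v]) \<ominus>\<^bsub>?L\<^esub> (free_gen R (xs[j := u]) \<oplus>\<^bsub>?L\<^esub> free_gen R (xs[j := v])) \<in> W"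
          using that xs j by (intro subsetD[OF rel]) (unfold tensor_rel_def Let_def, blast)
      qed (use that E(5) gu in auto)
      have smult: "free_gen R (xs[j := c \<odot>\<^bsub>M\<^esub> u]) \<in> W"
        if "c \<in> carrier R" "u \<in> carrier M" "c \<odot>\<^bsub>?L\<^esub> free_gen R (xs[j := u]) \<in> W" for c u
      proof (rule cancel)
        show "free_gen R (xs[j := c \<odot>\<^bsub>M\<^esub> u]) \<ominus>\<^bsub>?L\<^esub> c \<odot>\<^bsub>?L\<^esub> free_gen R (xs[j := u]) \<in> W"
          using that xs j by (intro subsetD[OF rel]) (unfold tensor_rel_def Let_def, blast)
      qed (use that gu in auto)
      have "submodule ?N R M"
      proof (rule M.submoduleI_closed)
        have "\<zero>\<^bsub>R\<^esub> \<odot>\<^bsub>?L\<^esub> free_gen R (xs[j := \<zero>\<^bsub>M\<^esub>]) \<in> W"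
          using L.submodule_zero[OF W] gu[of "\<zero>\<^bsub>M\<^esub>"] by simp
        then show "\<zero>\<^bsub>M\<^esub> \<in> ?N" using smult[of "\<zero>\<^bsub>R\<^esub>" "\<zero>\<^bsub>M\<^esub>"] by simp
      qed (use add smult E(4) in auto)
      moreover have "B \<subseteq> ?N"
      proof
        fix b assume b: "b \<in> B"
        then have "xs[j := b] ! i \<in> B" if "j \<le> i" "i < a" for i
          using Bs that len by (cases "i = j") auto
        then show "b \<in> ?N" using Suc b B(1) tuples_update[OF xs] by auto
      qed
      ultimately have "carrier M \<subseteq> ?N" using gen_submodule_least B(2) by metis
      moreover have "xs ! j \<in> carrier M" using xs j by (auto simp: tuples_def)
      ultimately show "free_gen R xs \<in> W" by (auto simp: list_update_id)
    qed
  qed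
  from this[of a] have "free_gen R xs \<in> W" if "xs \<in> tuples M a" for xs using that by auto
  then show ?thesis by (intro M.free_module_spanned[OF W])
qed

abbreviation tensor_class ::
    "('k, 'r) ring_scheme \<Rightarrow> ('k, 'm) module \<Rightarrow> nat \<Rightarrow> ('m list \<Rightarrow> 'k) \<Rightarrow> ('m list \<Rightarrow> 'k) set"
  where "tensor_class R M a \<psi> \<equiv> tensor_ker R M a +>\<^bsub>free_module R (tuples M a)\<^esub> \<psi>"

lemma tensor_class_hom:
  assumes "module R M"
  shows "tensor_class R M a \<in> mod_hom R (free_module R (tuples M a)) (tensor_power R M a)"
proof -
  interpret quot_mod R "free_module R (tuples M a)" "tensor_ker R M a" by (rule tensor_quot) fact
  show ?thesis
    by (auto simp: mod_hom_def tensor_power_def quot_carrier quot_add quot_smult)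
qed

lemma module_tensor_power: "module R M \<Longrightarrow> module R (tensor_power R M a)"
  unfolding tensor_power_def by (intro quot_mod.module_quot tensor_quot)

lemma tensor_class_eq_iff:
  assumes "module R M" "\<phi> \<in> carrier (free_module R (tuples M a))" "\<psi> \<in> carrier (free_module R (tuples M a))"
  shows "tensor_class R M a \<phi> = tensor_class R M a \<psi> \<longleftrightarrow>
    \<phi> \<oplus>\<^bsub>free_module R (tuples M a)\<^esub> \<ominus>\<^bsub>free_module R (tuples M a)\<^esub> \<psi> \<in> tensor_ker R M a"
  by (rule quot_mod.coset_eq_iff[OF tensor_quot]) (use assms in auto)

text \<open>The classes of the relations vanish, so the preimage of \<open>W\<close> in the free module on tuples is covered by
  the previous lemma on tuples of generators.\<close>

lemma tensor_power_generated:
  assumes M: "module R M" and B: "B \<subseteq> carrier M" "gen_submodule R M B = carrier M"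
    and W: "submodule W R (tensor_power R M a)"
    and gen: "\<And>xs. length xs = a \<Longrightarrow> set xs \<subseteq> B \<Longrightarrow> tensor_class R M a (free_gen R xs) \<in> W"
  shows "carrier (tensor_power R M a) \<subseteq> W"
proof -
  interpret M: module R M by fact
  let ?L = "free_module R (tuples M a)"
  interpret L: quot_mod R ?L "tensor_ker R M a" by (rule tensor_quot) fact
  interpret T: module R "tensor_power R M a" by (rule module_tensor_power) fact
  note hom = tensor_class_hom[OF M, of a]
  let ?W = "{\<psi> \<in> carrier ?L. tensor_class R M a \<psi> \<in> W}"
  have "carrier ?L \<subseteq> ?W"
  proof (rule free_tuples_spanned[OF M _ _ B])
    show "submodule ?W R ?L" by (rule preimage_submodule[OF L.module_axioms T.module_axioms hom W])
    show "tensor_ker R M a \<subseteq> ?W"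
    proof
      fix \<psi> assume \<psi>: "\<psi> \<in> tensor_ker R M a"
      then have c: "\<psi> \<in> carrier ?L" using L.submoduleE(1)[OF L.sub] by blast
      have "tensor_class R M a \<psi> = tensor_class R M a \<zero>\<^bsub>?L\<^esub>"
        using \<psi> c by (subst L.coset_eq_iff) auto
      also have "\<dots> = \<zero>\<^bsub>tensor_power R M a\<^esub>"
        by (rule mod_hom_zero[OF L.module_axioms T.module_axioms hom])
      finally show "\<psi> \<in> ?W" using c T.submodule_zero[OF W] by simp
    qed
    show "free_gen R xs \<in> ?W" if "length xs = a" "set xs \<subseteq> B" for xs
      using that gen B(1) M.free_gen_closed[of xs "tuples M a"] by (auto simp: tuples_def)
  qed
  then show ?thesis by (auto simp: tensor_power_def L.quot_carrier)
qed

section \<open>The kernel of the augmentation\<close>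

abbreviation aug_ker :: "('k, 'r) ring_scheme \<Rightarrow> 'x set \<Rightarrow> ('k, 'x \<Rightarrow> 'k) module"
  where "aug_ker R X \<equiv> ob (aug_ker_functor R) X"

definition free_diff :: "('k, 'r) ring_scheme \<Rightarrow> ('x \<Rightarrow> 'k) \<Rightarrow> ('x \<Rightarrow> 'k) \<Rightarrow> 'x \<Rightarrow> 'k"
  where "free_diff R v w = (\<lambda>s. v s \<ominus>\<^bsub>R\<^esub> w s)"

context cring
begin

lemma module_aug_ker: "(X :: 'x set) \<in> fin_sets \<Longrightarrow> module R (aug_ker R X)"
  using is_functor_aug_ker[OF cring_axioms, where 'x = 'x] unfolding is_functor_def by blast

lemma aug_ker_simps:
  "\<phi> \<in> carrier (aug_ker R X) \<longleftrightarrow> \<phi> \<in> carrier (free_module R X) \<and> augmentation R \<phi> = \<zero>"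
  "\<zero>\<^bsub>aug_ker R X\<^esub> = \<zero>\<^bsub>free_module R X\<^esub>"
  "\<phi> \<oplus>\<^bsub>aug_ker R X\<^esub> \<psi> = \<phi> \<oplus>\<^bsub>free_module R X\<^esub> \<psi>"
  "c \<odot>\<^bsub>aug_ker R X\<^esub> \<phi> = c \<odot>\<^bsub>free_module R X\<^esub> \<phi>"
  by (simp_all add: aug_ker_functor_def)

lemma free_diff_eq:
  assumes "v \<in> carrier (free_module R X)" "w \<in> carrier (free_module R X)"
  shows "free_diff R v w = v \<oplus>\<^bsub>free_module R X\<^esub> \<ominus>\<^bsub>free_module R X\<^esub> w"
  by (simp add: free_minus[OF assms(2)] free_simps(3) free_diff_def a_minus_def)

lemma free_map_diff:
  assumes f: "f \<in> X \<rightarrow> Y" and v: "v \<in> carrier (free_module R X)" "w \<in> carrier (free_module R X)"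
  shows "free_map R f (free_diff R v w) = free_diff R (free_map R f v) (free_map R f w)"
proof -
  interpret X: module R "free_module R X" by (rule module_free)
  note h = free_map_hom[OF f]
  show ?thesis
    using v mod_homD[OF h] mod_hom_minus[OF module_free module_free h]
    by (simp add: free_diff_eq[OF v] free_diff_eq[OF mod_homD(1)[OF h] mod_homD(1)[OF h]])
qed

lemma free_diff_gen_closed:
  assumes "x \<in> X" "y \<in> X"
  shows "free_diff R (free_gen R x) (free_gen R y) \<in> carrier (aug_ker R X)"
proof -
  interpret X: module R "free_module R X" by (rule module_free)
  note g = free_gen_closed[OF assms(1)] free_gen_closed[OF assms(2)]
  have "free_map R (\<lambda>_. ()) (free_diff R (free_gen R x) (free_gen R y)) () = \<zero>"
    by (subst free_map_diff[OF _ g, of _ UNIV])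
      (simp_all add: free_map_gen, simp add: free_diff_def free_gen_def a_minus_def r_neg)
  then show ?thesis
    using g by (simp add: aug_ker_simps augmentation_eq free_diff_eq[OF g])
qed

text \<open>Subtracting \<open>\<phi> x ([x] - [z])\<close> clears the coefficient of \<open>\<phi>\<close> at \<open>x\<close>. Once only the coefficient at
  \<open>z\<close> is left, it is the augmentation and hence zero.\<close>

lemma aug_ker_spanned:
  assumes "finite X" "z \<notin> X"
  shows "gen_submodule R (aug_ker R (insert z X)) ((\<lambda>x. free_diff R (free_gen R x) (free_gen R z)) ` X)
    = carrier (aug_ker R (insert z X))" (is "gen_submodule R ?M (?d ` X) = _")
proof
  interpret M: module R ?M by (rule module_aug_ker) (use assms in \<open>simp add: fin_sets_def\<close>)
  have d: "?d x \<in> carrier ?M" if "x \<in> X" for x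
    using that by (intro free_diff_gen_closed) auto
  then have dM: "?d ` X \<subseteq> carrier ?M" by blast
  let ?N = "gen_submodule R ?M (?d ` X)"
  show "?N \<subseteq> carrier ?M" by (rule gen_submodule_least[OF M.carrier_is_submodule dM])
  have N: "submodule ?N R ?M" by (rule gen_submodule_is_submodule[OF M.module_axioms dM])
  have dN: "?d x \<in> ?N" if "x \<in> X" for x using that gen_submodule_incl[of "?d ` X"] by blast
  note E = M.submoduleE[OF N]
  have "\<phi> \<in> ?N" if "finite A" "A \<subseteq> X" "\<phi> \<in> carrier ?M" "{s. \<phi> s \<noteq> \<zero>} \<subseteq> insert z A" for A \<phi>
    using that
  proof (induction A arbitrary: \<phi>)
    case empty
    have c: "\<phi> z \<in> carrier R" using empty.prems(2) by (simp add: aug_ker_simps free_simps)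
    have "\<phi> z = \<zero>"
    proof (rule ccontr)
      assume "\<phi> z \<noteq> \<zero>"
      then have "{s. \<phi> s \<noteq> \<zero>} = {z}" using empty.prems by auto
      then have "augmentation R \<phi> = \<phi> z" using c by (simp add: augmentation_def)
      then show False using empty.prems(2) \<open>\<phi> z \<noteq> \<zero>\<close> by (simp add: aug_ker_simps)
    qed
    then have "\<phi> = \<zero>\<^bsub>?M\<^esub>" using empty.prems(3) by (auto simp: aug_ker_simps free_simps)
    then show ?case using M.submodule_zero[OF N] by simp
  next
    case (insert x A)
    have c: "\<phi> s \<in> carrier R" for s using insert.prems(2) by (simp add: aug_ker_simps free_simps)
    have x: "x \<in> X" "x \<noteq> z" using insert.prems(1) assms(2) by auto
    let ?\<psi> = "\<phi> \<oplus>\<^bsub>?M\<^esub> (\<ominus> \<phi> x) \<odot>\<^bsub>?M\<^esub> ?d x"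
    have "?\<psi> s = \<zero>" if "s \<notin> insert z A" for s
      using that insert.prems(3) c x
      by (cases "s = x") (auto simp: aug_ker_simps free_simps free_diff_def free_gen_def a_minus_def r_neg)
    then have supp: "{s. ?\<psi> s \<noteq> \<zero>} \<subseteq> insert z A" by auto
    have "?\<psi> \<in> ?N"
      by (rule insert.IH) (use insert.prems c d x supp in auto)
    then have "?\<psi> \<oplus>\<^bsub>?M\<^esub> \<phi> x \<odot>\<^bsub>?M\<^esub> ?d x \<in> ?N" using E(4,5) c dN x by blast
    moreover have "?\<psi> \<oplus>\<^bsub>?M\<^esub> \<phi> x \<odot>\<^bsub>?M\<^esub> ?d x = \<phi>"
      using insert.prems(2) c d[OF x(1)] by (simp add: M.a_assoc M.smult_l_minus M.l_neg)
    ultimately show ?case by simp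
  qed
  moreover have "{s. \<phi> s \<noteq> \<zero>} \<subseteq> insert z X" if "\<phi> \<in> carrier ?M" for \<phi>
    using that by (auto simp: aug_ker_simps free_simps)
  ultimately show "carrier ?M \<subseteq> ?N" using assms(1) by blast
qed

end

section \<open>Linear extension and the determinant\<close>

definition lin_ext :: "('k, 'r) ring_scheme \<Rightarrow> ('s \<Rightarrow> 'k) \<Rightarrow> ('s \<Rightarrow> 'k) \<Rightarrow> 'k"
  where "lin_ext R g \<phi> = (\<Oplus>\<^bsub>R\<^esub> s \<in> {s. \<phi> s \<noteq> \<zero>\<^bsub>R\<^esub>}. \<phi> s \<otimes>\<^bsub>R\<^esub> g s)"

definition diagonal_product :: "('k, 'r) ring_scheme \<Rightarrow> 'x list \<Rightarrow> ('x \<Rightarrow> 'k) list \<Rightarrow> (nat \<Rightarrow> nat) \<Rightarrow> 'k"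
  where "diagonal_product R ys vs \<pi> = (\<Otimes>\<^bsub>R\<^esub> i \<in> {..<length ys}. (vs ! i) (ys ! \<pi> i))"

text \<open>The determinant of the matrix \<open>(vs ! i) (ys ! j)\<close> by the Leibniz formula. Even and odd permutations
  are summed separately, so that no sign has to be interpreted in \<open>R\<close>.\<close>

definition leibniz :: "('k, 'r) ring_scheme \<Rightarrow> 'x list \<Rightarrow> ('x \<Rightarrow> 'k) list \<Rightarrow> 'k"
  where "leibniz R ys vs =
    (\<Oplus>\<^bsub>R\<^esub> \<pi> \<in> {\<pi>. \<pi> permutes {..<length ys} \<and> evenperm \<pi>}. diagonal_product R ys vs \<pi>) \<ominus>\<^bsub>R\<^esub>
    (\<Oplus>\<^bsub>R\<^esub> \<pi> \<in> {\<pi>. \<pi> permutes {..<length ys} \<and> \<not> evenperm \<pi>}. diagonal_product R ys vs \<pi>)"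

context cring
begin

text \<open>The functional takes values in the free module on one point, which stands for \<open>R\<close> as a module over
  itself.\<close>

lemma lin_ext_hom:
  assumes g: "g \<in> S \<rightarrow> carrier R"
  shows "(\<lambda>\<phi> _. lin_ext R g \<phi>) \<in> mod_hom R (free_module R S) (free_module R (UNIV :: unit set))"
proof -
  interpret S: module R "free_module R S" by (rule module_free)
  have on: "lin_ext R g \<phi> = (\<Oplus>s \<in> B. \<phi> s \<otimes> g s)"
    if "\<phi> \<in> carrier (free_module R S)" "finite B" "{s. \<phi> s \<noteq> \<zero>} \<subseteq> B" "B \<subseteq> S" for \<phi> B
    unfolding lin_ext_def
    by (rule add.finprod_mono_neutral_cong_left) (use that g in \<open>auto simp: free_simps Pi_iff\<close>)
  have supp: "{s. \<phi> s \<noteq> \<zero>} \<subseteq> S" "finite {s. \<phi> s \<noteq> \<zero>}" if "\<phi> \<in> carrier (free_module R S)" for \<phi>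
    using that by (auto simp: free_simps)
  have closed: "(\<Oplus>s \<in> B. \<phi> s \<otimes> g s) \<in> carrier R" if "\<phi> \<in> carrier (free_module R S)" "B \<subseteq> S" for \<phi> B
    using that g by (intro finsum_closed) (auto simp: free_simps)
  show ?thesis unfolding mod_hom_def
  proof (intro CollectI conjI ballI)
    show "(\<lambda>\<phi> _. lin_ext R g \<phi>) \<in> carrier (free_module R S) \<rightarrow> carrier (free_module R (UNIV :: unit set))"
      using closed supp by (auto simp: lin_ext_def free_simps(1)[of _ _ "UNIV :: unit set"])
  next
    fix \<phi> \<psi> assume \<phi>: "\<phi> \<in> carrier (free_module R S)" and \<psi>: "\<psi> \<in> carrier (free_module R S)"
    let ?B = "{s. \<phi> s \<noteq> \<zero>} \<union> {s. \<psi> s \<noteq> \<zero>}"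
    have gB: "g s \<in> carrier R" if "\<phi> s \<noteq> \<zero> \<or> \<psi> s \<noteq> \<zero>" for s
      using that supp \<phi> \<psi> g by blast
    have "lin_ext R g (\<phi> \<oplus>\<^bsub>free_module R S\<^esub> \<psi>) = (\<Oplus>s \<in> ?B. (\<phi> s \<otimes> g s) \<oplus> (\<psi> s \<otimes> g s))"
      by (subst on[where B = ?B], use \<phi> \<psi> supp in simp, use supp \<phi> \<psi> in simp, force simp: free_simps, use supp \<phi> \<psi> in auto)
        (intro finsum_cong', use \<phi> \<psi> gB in \<open>auto simp: free_simps l_distr\<close>)
    also have "\<dots> = (\<Oplus>s \<in> ?B. \<phi> s \<otimes> g s) \<oplus> (\<Oplus>s \<in> ?B. \<psi> s \<otimes> g s)"
      by (rule finsum_addf) (use \<phi> \<psi> gB in \<open>auto simp: free_simps\<close>)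
    also have "\<dots> = lin_ext R g \<phi> \<oplus> lin_ext R g \<psi>"
      by (subst (1 2) on[where B = ?B]) (use \<phi> \<psi> supp in auto)
    finally show "(\<lambda>_. lin_ext R g (\<phi> \<oplus>\<^bsub>free_module R S\<^esub> \<psi>)) =
        (\<lambda>_. lin_ext R g \<phi>) \<oplus>\<^bsub>free_module R (UNIV :: unit set)\<^esub> (\<lambda>_. lin_ext R g \<psi>)"
      by (simp add: free_simps)
  next
    fix c \<phi> assume c: "c \<in> carrier R" and \<phi>: "\<phi> \<in> carrier (free_module R S)"
    let ?B = "{s. \<phi> s \<noteq> \<zero>}"
    have gB: "g s \<in> carrier R" if "\<phi> s \<noteq> \<zero>" for s
      using that supp \<phi> g by blast
    have "lin_ext R g (c \<odot>\<^bsub>free_module R S\<^esub> \<phi>) = (\<Oplus>s \<in> ?B. c \<otimes> (\<phi> s \<otimes> g s))"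
      by (subst on[where B = ?B], use c \<phi> in simp, use supp \<phi> in simp, use c in \<open>force simp: free_simps\<close>, use supp \<phi> in auto)
        (intro finsum_cong', use c \<phi> gB in \<open>auto simp: free_simps m_assoc\<close>)
    also have "\<dots> = c \<otimes> lin_ext R g \<phi>" unfolding lin_ext_def
      by (rule finsum_rdistr[symmetric]) (use c \<phi> gB in \<open>auto simp: free_simps\<close>)
    finally show "(\<lambda>_. lin_ext R g (c \<odot>\<^bsub>free_module R S\<^esub> \<phi>)) =
        c \<odot>\<^bsub>free_module R (UNIV :: unit set)\<^esub> (\<lambda>_. lin_ext R g \<phi>)"
      by (simp add: free_simps)
  qed
qed

lemma lin_ext_gen:
  assumes "g s \<in> carrier R"
  shows "lin_ext R g (free_gen R s) = g s"
proof (cases "\<one> = \<zero>")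
  case True
  then have "carrier R = {\<zero>}" using one_zeroD by blast
  then show ?thesis using assms True by (simp add: lin_ext_def free_gen_def)
next
  case False
  then have "{t. free_gen R s t \<noteq> \<zero>} = {s}" by (auto simp: free_gen_def)
  then show ?thesis using assms by (simp add: lin_ext_def free_gen_def)
qed

lemma diagonal_product_closed:
  assumes "length vs = length ys" "\<forall>v \<in> set vs. \<forall>s. v s \<in> carrier R"
  shows "diagonal_product R ys vs \<pi> \<in> carrier R"
  unfolding diagonal_product_def by (rule finprod_closed) (use assms in auto)

lemma leibniz_closed:
  assumes "length vs = length ys" "\<forall>v \<in> set vs. \<forall>s. v s \<in> carrier R"
  shows "leibniz R ys vs \<in> carrier R"
  unfolding leibniz_def using diagonal_product_closed[OF assms]
  by (intro minus_closed finsum_closed) auto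

lemma diagonal_product_update:
  assumes "length vs = length ys" "\<forall>v \<in> set vs. \<forall>s. v s \<in> carrier R" "i < length ys"
    and "\<And>s. u s \<in> carrier R"
  shows "diagonal_product R ys (vs[i := u]) \<pi> =
    u (ys ! \<pi> i) \<otimes> (\<Otimes>j \<in> {..<length ys} - {i}. (vs ! j) (ys ! \<pi> j))"
proof -
  have "diagonal_product R ys (vs[i := u]) \<pi> =
      (\<Otimes>j \<in> insert i ({..<length ys} - {i}). (vs[i := u] ! j) (ys ! \<pi> j))"
    using assms(3) by (simp add: diagonal_product_def insert_absorb)
  also have "\<dots> = u (ys ! \<pi> i) \<otimes> (\<Otimes>j \<in> {..<length ys} - {i}. (vs[i := u] ! j) (ys ! \<pi> j))"
    using assms by (subst finprod_insert) auto
  also have "(\<Otimes>j \<in> {..<length ys} - {i}. (vs[i := u] ! j) (ys ! \<pi> j)) =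
      (\<Otimes>j \<in> {..<length ys} - {i}. (vs ! j) (ys ! \<pi> j))"
    by (rule finprod_cong') (use assms in auto)
  finally show ?thesis .
qed

lemma leibniz_add:
  assumes vs: "length vs = length ys" "\<forall>v \<in> set vs. \<forall>s. v s \<in> carrier R" and i: "i < length ys"
    and u: "\<And>s. u s \<in> carrier R" and v: "\<And>s. v s \<in> carrier R"
  shows "leibniz R ys (vs[i := (\<lambda>s. u s \<oplus> v s)]) = leibniz R ys (vs[i := u]) \<oplus> leibniz R ys (vs[i := v])"
proof -
  have c: "diagonal_product R ys (vs[i := w]) \<pi> \<in> carrier R" if "\<And>s. w s \<in> carrier R" for w \<pi>
    by (rule diagonal_product_closed) (use that vs set_update_subset_insert[of vs i w] in auto)
  have dp: "diagonal_product R ys (vs[i := (\<lambda>s. u s \<oplus> v s)]) \<pi> =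
      diagonal_product R ys (vs[i := u]) \<pi> \<oplus> diagonal_product R ys (vs[i := v]) \<pi>" for \<pi>
  proof -
    have "(\<Otimes>j \<in> {..<length ys} - {i}. (vs ! j) (ys ! \<pi> j)) \<in> carrier R"
      by (rule finprod_closed) (use vs in auto)
    then show ?thesis using u v by (simp add: diagonal_product_update[OF vs i] l_distr)
  qed
  have "(\<Oplus>\<pi> \<in> P. diagonal_product R ys (vs[i := (\<lambda>s. u s \<oplus> v s)]) \<pi>) =
      (\<Oplus>\<pi> \<in> P. diagonal_product R ys (vs[i := u]) \<pi>) \<oplus> (\<Oplus>\<pi> \<in> P. diagonal_product R ys (vs[i := v]) \<pi>)" for P
    unfolding dp by (rule finsum_addf) (use c u v in blast)+
  moreover have "(\<Oplus>\<pi> \<in> P. diagonal_product R ys (vs[i := w]) \<pi>) \<in> carrier R" if "\<And>s. w s \<in> carrier R" for P w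
    by (rule finsum_closed) (use c that in blast)
  ultimately show ?thesis using u v
    by (simp add: leibniz_def a_minus_def minus_add a_ac)
qed

lemma leibniz_smult:
  assumes vs: "length vs = length ys" "\<forall>v \<in> set vs. \<forall>s. v s \<in> carrier R" and i: "i < length ys"
    and u: "\<And>s. u s \<in> carrier R" and k: "k \<in> carrier R"
  shows "leibniz R ys (vs[i := (\<lambda>s. k \<otimes> u s)]) = k \<otimes> leibniz R ys (vs[i := u])"
proof -
  have c: "diagonal_product R ys (vs[i := u]) \<pi> \<in> carrier R" for \<pi>
    by (rule diagonal_product_closed) (use u vs set_update_subset_insert[of vs i u] in auto)
  have dp: "diagonal_product R ys (vs[i := (\<lambda>s. k \<otimes> u s)]) \<pi> = k \<otimes> diagonal_product R ys (vs[i := u]) \<pi>" for \<pi>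
  proof -
    have "(\<Otimes>j \<in> {..<length ys} - {i}. (vs ! j) (ys ! \<pi> j)) \<in> carrier R"
      by (rule finprod_closed) (use vs in auto)
    then show ?thesis using u k by (simp add: diagonal_product_update[OF vs i] m_assoc)
  qed
  have "(\<Oplus>\<pi> \<in> P. diagonal_product R ys (vs[i := (\<lambda>s. k \<otimes> u s)]) \<pi>) =
      k \<otimes> (\<Oplus>\<pi> \<in> P. diagonal_product R ys (vs[i := u]) \<pi>)" if "finite P" for P
    unfolding dp by (rule finsum_rdistr[symmetric]) (use that c k in blast)+
  moreover have "(\<Oplus>\<pi> \<in> P. diagonal_product R ys (vs[i := u]) \<pi>) \<in> carrier R" for P
    by (rule finsum_closed) (use c in blast)
  ultimately show ?thesis using k finite_permutations[of "{..<length ys}"]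
    by (simp add: leibniz_def a_minus_def r_distr r_minus)
qed

lemma leibniz_zero_vector:
  assumes vs: "length vs = length ys" "\<forall>v \<in> set vs. \<forall>s. v s \<in> carrier R" and "i < length ys"
    and "vs ! i = (\<lambda>_. \<zero>)"
  shows "leibniz R ys vs = \<zero>"
  using leibniz_smult[OF vs assms(3), of "\<lambda>_. \<zero>" \<zero>] leibniz_closed[OF vs] list_update_id[of vs i] assms(4)
  by simp

text \<open>Composition with the transposition of \<open>i\<close> and \<open>j\<close> matches the even permutations with the odd ones
  and does not change the diagonal products.\<close>

lemma leibniz_equal_vectors:
  assumes vs: "length vs = length ys" "\<forall>v \<in> set vs. \<forall>s. v s \<in> carrier R"
    and ij: "i < length ys" "j < length ys" "i \<noteq> j" "vs ! i = vs ! j"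
  shows "leibniz R ys vs = \<zero>"
proof -
  let ?n = "{..<length ys}" and ?t = "transpose i j" and ?P = "diagonal_product R ys vs"
  let ?E = "{\<pi>. \<pi> permutes ?n \<and> evenperm \<pi>}" and ?O = "{\<pi>. \<pi> permutes ?n \<and> \<not> evenperm \<pi>}"
  note c = diagonal_product_closed[OF vs]
  have t: "?t permutes ?n" using ij by (intro permutes_swap_id) auto
  have pt: "\<pi> \<circ> ?t permutes ?n" if "\<pi> permutes ?n" for \<pi>
    by (rule permutes_compose[OF t that])
  have ev: "evenperm (\<pi> \<circ> ?t) \<longleftrightarrow> \<not> evenperm \<pi>" if "\<pi> permutes ?n" for \<pi>
    using evenperm_comp[OF permutation_permutes[THEN iffD2] permutation_swap_id, of \<pi> i j] that ij(3)
    by (auto simp: evenperm_swap)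
  have "\<pi> = (\<pi> \<circ> ?t) \<circ> ?t" for \<pi> :: "nat \<Rightarrow> nat" by (simp add: fun_eq_iff)
  then have O: "?O = (\<lambda>\<pi>. \<pi> \<circ> ?t) ` ?E"
    using pt ev by (fastforce simp: image_iff)
  have inj: "inj_on (\<lambda>\<pi>. \<pi> \<circ> ?t) ?E"
    by (rule inj_onI) (metis comp_assoc transpose_comp_involutory comp_id)
  have "?P (\<pi> \<circ> ?t) = ?P \<pi>" for \<pi>
  proof -
    have "?P \<pi> = (\<Otimes>l \<in> ?t ` ?n. (vs ! l) (ys ! \<pi> l))"
      using permutes_image[OF t] by (simp add: diagonal_product_def)
    also have "\<dots> = (\<Otimes>l \<in> ?n. (vs ! ?t l) (ys ! \<pi> (?t l)))"
      by (rule finprod_reindex) (use vs permutes_image[OF t] in auto)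
    also have "\<dots> = ?P (\<pi> \<circ> ?t)" unfolding diagonal_product_def
      by (rule finprod_cong') (use vs ij in \<open>auto simp: transpose_def\<close>)
    finally show ?thesis by simp
  qed
  then have "(\<Oplus>\<pi> \<in> ?O. ?P \<pi>) = (\<Oplus>\<pi> \<in> ?E. ?P \<pi>)"
    unfolding O using c by (subst add.finprod_reindex[OF _ inj]) auto
  moreover have "(\<Oplus>\<pi> \<in> ?E. ?P \<pi>) \<in> carrier R" by (rule finsum_closed) (use c in blast)
  ultimately show ?thesis by (simp add: leibniz_def a_minus_def r_neg)
qed

text \<open>As \<open>y\<close> is not among the columns \<open>ys\<close>, the matrix is the identity matrix.\<close>

lemma leibniz_unit:
  assumes "distinct (y # ys)"
  shows "leibniz R ys (map (\<lambda>x. free_diff R (free_gen R x) (free_gen R y)) ys) = \<one>"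
proof -
  let ?n = "{..<length ys}" and ?vs = "map (\<lambda>x. free_diff R (free_gen R x) (free_gen R y)) ys"
  let ?P = "diagonal_product R ys ?vs"
  let ?E = "{\<pi>. \<pi> permutes ?n \<and> evenperm \<pi>}" and ?O = "{\<pi>. \<pi> permutes ?n \<and> \<not> evenperm \<pi>}"
  have entry: "(?vs ! i) (ys ! j) = (if i = j then \<one> else \<zero>)" if "i < length ys" "j < length ys" for i j
    using that assms by (auto simp: free_diff_def free_gen_def a_minus_def nth_eq_iff_index_eq)
  have P: "?P \<pi> = (if \<pi> = id then \<one> else \<zero>)" if \<pi>: "\<pi> permutes ?n" for \<pi>
  proof (cases "\<pi> = id")
    case True
    then show ?thesis using entry unfolding diagonal_product_def
      by (simp del: nth_map) (intro finprod_one_eqI, simp del: nth_map)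
  next
    case False
    then obtain i where i: "\<pi> i \<noteq> i" by (auto simp: fun_eq_iff)
    then have i': "i < length ys" "\<pi> i < length ys"
      using \<pi> permutes_not_in permutes_in_image by (metis lessThan_iff)+
    have c: "(\<lambda>j. (?vs ! j) (ys ! \<pi> j)) \<in> A \<rightarrow> carrier R" if A: "A \<subseteq> ?n" for A
    proof
      fix j assume "j \<in> A"
      with A have "j < length ys" by blast
      then show "(?vs ! j) (ys ! \<pi> j) \<in> carrier R" by (simp add: free_diff_def free_gen_def)
    qed
    have "?P \<pi> = (\<Otimes>j \<in> insert i (?n - {i}). (?vs ! j) (ys ! \<pi> j))"
      using i' by (simp add: diagonal_product_def insert_absorb)
    also have "\<dots> = (?vs ! i) (ys ! \<pi> i) \<otimes> (\<Otimes>j \<in> ?n - {i}. (?vs ! j) (ys ! \<pi> j))"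
      using i' c[of "?n - {i}"] c[of "{i}"] by (subst finprod_insert) auto
    also have "\<dots> = \<zero>" using entry[OF i'] i c[of "?n - {i}"] by simp
    finally show ?thesis using False by simp
  qed
  have "(\<Oplus>\<pi> \<in> ?E. ?P \<pi>) = (\<Oplus>\<pi> \<in> {id :: nat \<Rightarrow> nat}. \<one>)"
  proof (rule sym, rule add.finprod_mono_neutral_cong_left)
    show "finite ?E" using finite_permutations[of ?n] by simp
    show "{id} \<subseteq> ?E" using permutes_id by auto
    show "?P \<pi> = \<zero>" if "\<pi> \<in> ?E - {id}" for \<pi> using that P[of \<pi>] by simp
    show "\<one> = ?P \<pi>" if "\<pi> \<in> {id}" for \<pi> using that P[OF permutes_id] by simp
    show "?P \<in> ?E \<rightarrow> carrier R" using P by (intro funcsetI) simp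
  qed
  moreover have "(\<Oplus>\<pi> \<in> ?O. ?P \<pi>) = (\<Oplus>\<pi> \<in> ?O. \<zero>)"
  proof (rule finsum_cong')
    show "?P \<pi> = \<zero>" if "\<pi> \<in> ?O" for \<pi>
    proof -
      have "\<pi> \<noteq> id" using that by auto
      then show ?thesis using that P[of \<pi>] by simp
    qed
  qed simp_all
  ultimately show ?thesis by (simp add: leibniz_def a_minus_def)
qed

text \<open>The determinant descends to the tensor power because it is linear in each row.\<close>

lemma leibniz_tensor_ker:
  assumes X: "X \<in> fin_sets" and \<psi>: "\<psi> \<in> tensor_ker R (aug_ker R X) (length ys)"
  shows "lin_ext R (leibniz R ys) \<psi> = \<zero>"
proof -
  let ?M = "aug_ker R X" and ?a = "length ys" and ?U = "free_module R (UNIV :: unit set)"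
  let ?L = "free_module R (tuples ?M ?a)"
  interpret M: module R ?M by (rule module_aug_ker[OF X])
  interpret L: module R ?L by (rule module_free)
  interpret U: module R ?U by (rule module_free)
  have val: "v s \<in> carrier R" if "v \<in> carrier ?M" for v s
    using that by (simp add: aug_ker_simps free_simps)
  then have vals: "length xs = length ys" "\<forall>v \<in> set xs. \<forall>s. v s \<in> carrier R" if "xs \<in> tuples ?M ?a" for xs
    using that by (auto simp: tuples_def)
  define h where "h = (\<lambda>\<phi> (_ :: unit). lin_ext R (leibniz R ys) \<phi>)"
  have h: "h \<in> mod_hom R ?L ?U"
    unfolding h_def by (intro lin_ext_hom funcsetI leibniz_closed vals)
  have hg: "h (free_gen R xs) = (\<lambda>_. leibniz R ys xs)" if "xs \<in> tuples ?M ?a" for xs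
    unfolding h_def by (simp add: lin_ext_gen leibniz_closed[OF vals[OF that]])
  note hD = mod_homD[OF h] mod_hom_minus[OF L.module_axioms U.module_axioms h]
  note upd = tuples_update[where M = ?M and a = ?a]
  have "tensor_rel R ?M ?a \<subseteq> {\<phi> \<in> carrier ?L. h \<phi> = \<zero>\<^bsub>?U\<^esub>}"
  proof
    fix \<rho> assume \<rho>: "\<rho> \<in> tensor_rel R ?M ?a"
    then have c: "\<rho> \<in> carrier ?L" using tensor_rel_subset[OF M.module_axioms] by blast
    have "h \<rho> = \<zero>\<^bsub>?U\<^esub>"
      using \<rho> unfolding tensor_rel_def Let_def
    proof (elim UnE CollectE exE conjE)
      fix xs i u v
      assume \<rho>: "\<rho> = free_gen R (xs[i := u \<oplus>\<^bsub>?M\<^esub> v]) \<ominus>\<^bsub>?L\<^esub> (free_gen R (xs[i := u]) \<oplus>\<^bsub>?L\<^esub> free_gen R (xs[i := v]))"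
        and xs: "xs \<in> tuples ?M ?a" and i: "i < ?a" and u: "u \<in> carrier ?M" and v: "v \<in> carrier ?M"
      note t = upd[OF xs u] upd[OF xs v] upd[OF xs M.M.a_closed[OF u v]]
      note g = t[THEN free_gen_closed]
      have "h (free_gen R (xs[i := u \<oplus>\<^bsub>?M\<^esub> v])) = h (free_gen R (xs[i := u])) \<oplus>\<^bsub>?U\<^esub> h (free_gen R (xs[i := v]))"
        unfolding hg[OF t(1)] hg[OF t(2)] hg[OF t(3)]
        using leibniz_add[OF vals[OF xs] i val[OF u] val[OF v]] by (simp add: aug_ker_simps free_simps)
      then show "h \<rho> = \<zero>\<^bsub>?U\<^esub>"
        unfolding \<rho> a_minus_def using g hD(1)[OF g(1)] hD(1)[OF g(2)]
        by (simp add: hD U.r_neg)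
    next
      fix xs i k u
      assume \<rho>: "\<rho> = free_gen R (xs[i := k \<odot>\<^bsub>?M\<^esub> u]) \<ominus>\<^bsub>?L\<^esub> k \<odot>\<^bsub>?L\<^esub> free_gen R (xs[i := u])"
        and xs: "xs \<in> tuples ?M ?a" and i: "i < ?a" and k: "k \<in> carrier R" and u: "u \<in> carrier ?M"
      note t = upd[OF xs u] upd[OF xs M.smult_closed[OF k u]]
      note g = t[THEN free_gen_closed]
      have "h (free_gen R (xs[i := k \<odot>\<^bsub>?M\<^esub> u])) = k \<odot>\<^bsub>?U\<^esub> h (free_gen R (xs[i := u]))"
        unfolding hg[OF t(1)] hg[OF t(2)]
        using leibniz_smult[OF vals[OF xs] i val[OF u] k] by (simp add: aug_ker_simps free_simps)
      then show "h \<rho> = \<zero>\<^bsub>?U\<^esub>"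
        unfolding \<rho> a_minus_def using g k hD(1)[OF g(1)]
        by (simp add: hD U.r_neg)
    qed
    with c show "\<rho> \<in> {\<phi> \<in> carrier ?L. h \<phi> = \<zero>\<^bsub>?U\<^esub>}" by simp
  qed
  then have "tensor_ker R ?M ?a \<subseteq> {\<phi> \<in> carrier ?L. h \<phi> = \<zero>\<^bsub>?U\<^esub>}"
    unfolding tensor_ker_def
    by (rule gen_submodule_least[OF mod_hom_kernel_submodule[OF L.module_axioms U.module_axioms h]])
  then have "h \<psi> = \<zero>\<^bsub>?U\<^esub>" using \<psi> by blast
  then show ?thesis by (simp add: h_def free_simps fun_eq_iff)
qed

end

section \<open>The functor of words\<close>

text \<open>An isomorphic copy of \<open>M\<close> whose elements are sets. Projectivity of a functor is only tested on functors
  with values in the same type, and the elements of a tensor power are cosets, that is, sets of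
  functions on lists.\<close>

definition singletons :: "('k, 'm) module \<Rightarrow> ('k, 'm set) module"
  where "singletons M =
    \<lparr>carrier = (\<lambda>v. {v}) ` carrier M,
     monoid.mult = undefined, one = undefined,
     zero = {\<zero>\<^bsub>M\<^esub>},
     add = (\<lambda>A B. {the_elem A \<oplus>\<^bsub>M\<^esub> the_elem B}),
     smult = (\<lambda>c A. {c \<odot>\<^bsub>M\<^esub> the_elem A})\<rparr>"

text \<open>The word \<open>x\<^sub>1 \<dots> x\<^sub>n\<close> is encoded as the list of the generators \<open>[x\<^sub>1], \<dots>, [x\<^sub>n]\<close> for the same
  reason: tensors are built from lists of functions. It also makes \<open>free_map R f\<close> act on the letters.\<close>

definition words :: "('k, 'r) ring_scheme \<Rightarrow> nat \<Rightarrow> 'x set \<Rightarrow> ('x \<Rightarrow> 'k) list set"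
  where "words R n X = {map (free_gen R) xs | xs. length xs = n \<and> set xs \<subseteq> X}"

text \<open>Up to the encoding this is \<open>X \<mapsto> k[X\<^sup>n]\<close>, the linearization of a representable functor.\<close>

definition word_functor ::
    "('k, 'r) ring_scheme \<Rightarrow> nat \<Rightarrow> ('x, 'k, (('x \<Rightarrow> 'k) list \<Rightarrow> 'k) set) fin_functor"
  where "word_functor R n =
    \<lparr>ob = (\<lambda>X. singletons (free_module R (words R n X))),
     mor = (\<lambda>X Y f A. {free_map R (map (free_map R f)) (the_elem A)})\<rparr>"

lemma module_singletons:
  assumes "module R M"
  shows "module R (singletons M)"
proof -
  interpret M: module R M by fact
  show ?thesis
  proof (rule moduleI)
    show "abelian_group (singletons M)"
    proof (rule abelian_groupI)
      fix A assume "A \<in> carrier (singletons M)"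
      then show "\<exists>B \<in> carrier (singletons M). B \<oplus>\<^bsub>singletons M\<^esub> A = \<zero>\<^bsub>singletons M\<^esub>"
        by (auto simp: singletons_def M.M.l_neg intro: bexI[of _ "\<ominus>\<^bsub>M\<^esub> the_elem A"])
    qed (auto simp: singletons_def M.M.a_ac)
  qed (auto simp: singletons_def M.R.cring_axioms M.smult_l_distr M.smult_r_distr M.smult_assoc1)
qed

lemma singletons_hom:
  "the_elem \<in> mod_hom R (singletons M) M"
  "h \<in> mod_hom R M N \<Longrightarrow> (\<lambda>A. {h (the_elem A)}) \<in> mod_hom R (singletons M) (singletons N)"
  by (auto simp: mod_hom_def singletons_def Pi_def)

context cring
begin

lemma words_map:
  "f \<in> X \<rightarrow> Y \<Longrightarrow> map (free_map R f) \<in> words R n X \<rightarrow> words R n Y"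
proof (rule funcsetI)
  fix ms assume f: "f \<in> X \<rightarrow> Y" and "ms \<in> words R n X"
  then obtain xs where xs: "ms = map (free_gen R) xs" "length xs = n" "set xs \<subseteq> X" by (auto simp: words_def)
  then have "map (free_map R f) ms = map (free_gen R) (map f xs)" by (simp add: free_map_gen)
  moreover have "length (map f xs) = n" "set (map f xs) \<subseteq> Y" using xs f by auto
  ultimately show "map (free_map R f) ms \<in> words R n Y" unfolding words_def by blast
qed

lemma words_subset_free: "ms \<in> words R n X \<Longrightarrow> set ms \<subseteq> carrier (free_module R X)"
  by (auto simp: words_def intro!: free_gen_closed)

lemma word_map_id:
  assumes "ms \<in> words R n X" "\<And>x. x \<in> X \<Longrightarrow> f x = x"
  shows "map (free_map R f) ms = ms"
  using words_subset_free[OF assms(1)] free_map_id[OF _ assms(2)] by (intro map_idI) blast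

lemma word_functor_hom:
  "f \<in> X \<rightarrow> Y \<Longrightarrow> mor (word_functor R n) X Y f \<in> mod_hom R (ob (word_functor R n) X) (ob (word_functor R n) Y)"
  unfolding word_functor_def
  by (simp, intro singletons_hom free_map_hom words_map)

lemma is_functor_word: "is_functor R (word_functor R n)"
  unfolding is_functor_def
proof (intro conjI ballI)
  fix X :: "'c set"
  show "module R (ob (word_functor R n) X)"
    by (simp add: word_functor_def module_singletons module_free)
next
  fix X Y :: "'c set" and f :: "'c \<Rightarrow> 'c" assume "f \<in> X \<rightarrow>\<^sub>E Y"
  then show "mor (word_functor R n) X Y f \<in> mod_hom R (ob (word_functor R n) X) (ob (word_functor R n) Y)"
    by (intro word_functor_hom) auto
next
  fix X :: "'c set" and v assume "v \<in> carrier (ob (word_functor R n) X)"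
  then obtain \<phi> where \<phi>: "v = {\<phi>}" "\<phi> \<in> carrier (free_module R (words R n X))"
    by (auto simp: word_functor_def singletons_def)
  have "free_map R (map (free_map R (\<lambda>x\<in>X. x))) \<phi> = \<phi>"
    by (rule free_map_id[OF \<phi>(2)]) (auto intro: word_map_id)
  then show "mor (word_functor R n) X X (\<lambda>x\<in>X. x) v = v"
    by (simp add: word_functor_def \<phi>(1))
next
  fix X Y Z :: "'c set" and f g :: "'c \<Rightarrow> 'c" and v assume "v \<in> carrier (ob (word_functor R n) X)"
  then obtain \<phi> where \<phi>: "v = {\<phi>}" "\<phi> \<in> carrier (free_module R (words R n X))"
    by (auto simp: word_functor_def singletons_def)
  have "map (free_map R (compose X g f)) ms = map (free_map R g) (map (free_map R f) ms)"
    if "ms \<in> words R n X" for ms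
    using that by (auto simp: words_def free_map_gen compose_def subset_iff)
  then have "free_map R (map (free_map R (compose X g f))) \<phi> =
      free_map R (\<lambda>ms. map (free_map R g) (map (free_map R f) ms)) \<phi>"
    by (rule free_map_cong[OF \<phi>(2)])
  also have "\<dots> = free_map R (map (free_map R g)) (free_map R (map (free_map R f)) \<phi>)"
    by (rule free_map_comp[OF \<phi>(2)])
  finally show "mor (word_functor R n) X Z (compose X g f) v =
      mor (word_functor R n) Y Z g (mor (word_functor R n) X Y f v)"
    by (simp add: word_functor_def \<phi>(1))
qed

lemma inclusion_word:
  assumes "S \<subseteq> X" and A: "A \<in> carrier (ob (word_functor R n) S)"
  shows "mor (word_functor R n) S X (\<lambda>x\<in>S. x) A = A"
proof -
  from A obtain \<phi> where \<phi>: "A = {\<phi>}" "\<phi> \<in> carrier (free_module R (words R n S))"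
    by (auto simp: word_functor_def singletons_def)
  have "free_map R (map (free_map R (\<lambda>x\<in>S. x))) \<phi> = \<phi>"
    by (rule free_map_id[OF \<phi>(2)]) (auto intro: word_map_id)
  then show ?thesis by (simp add: word_functor_def \<phi>(1))
qed

end

section \<open>From words to tensors\<close>

definition differences :: "('k, 'r) ring_scheme \<Rightarrow> ('x \<Rightarrow> 'k) list \<Rightarrow> ('x \<Rightarrow> 'k) list"
  where "differences R ms = map (\<lambda>v. free_diff R v (hd ms)) (tl ms)"

text \<open>The epimorphism \<open>[x\<^sub>0, \<dots>, x\<^sub>a] \<mapsto> ([x\<^sub>1] - [x\<^sub>0]) \<otimes> \<dots> \<otimes> ([x\<^sub>a] - [x\<^sub>0])\<close>.\<close>

definition words_to_tensors ::
    "('k, 'r) ring_scheme \<Rightarrow> nat \<Rightarrow> 'x set \<Rightarrow>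
     (('x \<Rightarrow> 'k) list \<Rightarrow> 'k) set \<Rightarrow> (('x \<Rightarrow> 'k) list \<Rightarrow> 'k) set"
  where "words_to_tensors R a X A =
    tensor_class R (aug_ker R X) a (free_map R (differences R) (the_elem A))"

lemma nat_transD:
  assumes "nat_trans R F G \<eta>" "X \<in> fin_sets"
  shows "\<eta> X \<in> mod_hom R (ob F X) (ob G X)"
    and "v \<in> carrier (ob F X) \<Longrightarrow> \<eta> X v \<in> carrier (ob G X)"
    and "Y \<in> fin_sets \<Longrightarrow> f \<in> X \<rightarrow>\<^sub>E Y \<Longrightarrow> v \<in> carrier (ob F X) \<Longrightarrow> \<eta> Y (mor F X Y f v) = mor G X Y f (\<eta> X v)"
  using assms by (auto simp: nat_trans_def mod_hom_def)

lemma image_list: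
  assumes "set us \<subseteq> h ` X"
  obtains xs where "us = map h xs" "set xs \<subseteq> X" "length xs = length us"
proof -
  have "us \<in> lists (h ` X)" using assms by auto
  then obtain xs where "us = map h xs" "xs \<in> lists X" by (auto simp: lists_image)
  then show thesis by (intro that) auto
qed

context cring
begin

lemma differences_word:
  "differences R (map (free_gen R) (y # ys)) = map (\<lambda>x. free_diff R (free_gen R x) (free_gen R y)) ys"
  by (simp add: differences_def)

lemma words_Suc_cases:
  assumes "ms \<in> words R (Suc n) X"
  obtains y ys where "ms = map (free_gen R) (y # ys)" "length ys = n" "y \<in> X" "set ys \<subseteq> X"
  using assms by (auto simp: words_def length_Suc_conv)

lemma differences_closed: "differences R \<in> words R (Suc a) X \<rightarrow> tuples (aug_ker R X) a"
proof
  fix ms assume "ms \<in> words R (Suc a) X"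
  then obtain y ys where "ms = map (free_gen R) (y # ys)" "length ys = a" "y \<in> X" "set ys \<subseteq> X"
    by (rule words_Suc_cases)
  then show "differences R ms \<in> tuples (aug_ker R X) a"
    by (auto simp: differences_def tuples_def intro!: free_diff_gen_closed)
qed

lemma differences_map:
  assumes "ms \<in> words R (Suc a) X" and f: "f \<in> X \<rightarrow> Y"
  shows "differences R (map (free_map R f) ms) = map (free_map R f) (differences R ms)"
proof -
  from assms(1) obtain y ys where y: "ms = map (free_gen R) (y # ys)" "y \<in> X" "set ys \<subseteq> X"
    by (rule words_Suc_cases)
  have "free_map R f (free_diff R (free_gen R x) (free_gen R y)) =
      free_diff R (free_gen R (f x)) (free_gen R (f y))" if "x \<in> X" for x
    using free_map_diff[OF f free_gen_closed[OF that] free_gen_closed[OF y(2)]] by (simp add: free_map_gen)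
  then show ?thesis using y by (auto simp: differences_def free_map_gen)
qed

text \<open>If the first letter is repeated, one of the differences is zero; otherwise two of them are equal.\<close>

lemma leibniz_differences_nondistinct:
  assumes "length xs = Suc (length ys)" "\<not> distinct xs"
  shows "leibniz R ys (differences R (map (free_gen R) xs)) = \<zero>"
proof -
  obtain w ws where xs: "xs = w # ws" "length ws = length ys" using assms(1) by (auto simp: length_Suc_conv)
  let ?vs = "map (\<lambda>x. free_diff R (free_gen R x) (free_gen R w)) ws"
  have vs: "length ?vs = length ys" "\<forall>v \<in> set ?vs. \<forall>s. v s \<in> carrier R"
    using xs by (auto simp: free_diff_def free_gen_def)
  have "leibniz R ys ?vs = \<zero>"
  proof (cases "w \<in> set ws")
    case True
    then obtain i where i: "i < length ys" "ws ! i = w" using xs(2) by (metis in_set_conv_nth)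
    then have "?vs ! i = (\<lambda>_. \<zero>)" using xs(2) by (simp add: free_diff_def free_gen_def a_minus_def r_neg)
    then show ?thesis by (rule leibniz_zero_vector[OF vs i(1)])
  next
    case False
    then have "\<not> distinct ws" using assms(2) xs by simp
    then obtain i j where ij: "i < length ys" "j < length ys" "i \<noteq> j" "ws ! i = ws ! j"
      using xs(2) by (auto simp: distinct_conv_nth)
    then have "?vs ! i = ?vs ! j" using xs(2) by simp
    then show ?thesis by (rule leibniz_equal_vectors[OF vs ij(1-3)])
  qed
  then show ?thesis unfolding xs(1) differences_word .
qed

abbreviation tensor_aug :: "nat \<Rightarrow> ('x, 'a, (('x \<Rightarrow> 'a) list \<Rightarrow> 'a) set) fin_functor"
  where "tensor_aug a \<equiv> tensor_power_functor R (aug_ker_functor R) a"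

lemma tensor_aug_ob: "ob (tensor_aug a) X = tensor_power R (aug_ker R X) a"
  by (simp add: tensor_power_functor_def)

lemma free_map_aug_hom:
  fixes X Y :: "'x set"
  assumes "X \<in> fin_sets" "Y \<in> fin_sets" "f \<in> X \<rightarrow>\<^sub>E Y"
  shows "free_map R f \<in> mod_hom R (aug_ker R X) (aug_ker R Y)"
proof -
  have "mor (aug_ker_functor R) X Y f \<in> mod_hom R (aug_ker R X) (aug_ker R Y)"
    using is_functor_aug_ker[OF cring_axioms, where 'x = 'x] assms unfolding is_functor_def by blast
  then show ?thesis by (simp add: aug_ker_functor_def)
qed

lemma tensor_aug_mor:
  fixes X Y :: "'x set"
  assumes "X \<in> fin_sets" "Y \<in> fin_sets" "f \<in> X \<rightarrow>\<^sub>E Y"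
    and "\<phi> \<in> carrier (free_module R (tuples (aug_ker R X) a))"
  shows "mor (tensor_aug a) X Y f (tensor_class R (aug_ker R X) a \<phi>) =
    tensor_class R (aug_ker R Y) a (free_map R (map (free_map R f)) \<phi>)"
proof -
  have "mor (tensor_aug a) X Y f = tensor_power_map R (aug_ker R Y) a (free_map R f)"
    by (simp add: tensor_power_functor_def) (simp add: aug_ker_functor_def)
  then show ?thesis
    using tensor_map_coset[OF module_aug_ker module_aug_ker free_map_aug_hom] assms by simp
qed

lemma inclusion_tensor:
  assumes "S \<subseteq> (X :: 'x set)" "S \<in> fin_sets" "X \<in> fin_sets" and us: "us \<in> tuples (aug_ker R S) a"
  shows "mor (tensor_aug a) S X (\<lambda>x\<in>S. x) (tensor_class R (aug_ker R S) a (free_gen R us)) =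
    tensor_class R (aug_ker R X) a (free_gen R us)"
proof -
  have "map (free_map R (\<lambda>x\<in>S. x)) us = us"
  proof (rule map_idI)
    fix u assume "u \<in> set us"
    then have "u \<in> carrier (free_module R S)" using us by (auto simp: tuples_def aug_ker_simps)
    then show "free_map R (\<lambda>x\<in>S. x) u = u" by (rule free_map_id) simp
  qed
  moreover have "(\<lambda>x\<in>S. x) \<in> S \<rightarrow>\<^sub>E X" using assms(1) by auto
  ultimately show ?thesis
    using tensor_aug_mor[OF assms(2,3) _ free_gen_closed[OF us]] by (simp add: free_map_gen)
qed

lemma words_to_tensors_nat:
  "nat_trans R (word_functor R (Suc a)) (tensor_aug a) (words_to_tensors R a :: 'x set \<Rightarrow> _)"
  unfolding nat_trans_def
proof (intro conjI ballI)
  fix X :: "'x set" assume X: "X \<in> fin_sets"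
  have "(\<lambda>A. tensor_class R (aug_ker R X) a (free_map R (differences R) (the_elem A)))
    \<in> mod_hom R (singletons (free_module R (words R (Suc a) X))) (tensor_power R (aug_ker R X) a)"
    by (rule mod_hom_comp[OF mod_hom_comp[OF singletons_hom(1) free_map_hom[OF differences_closed]]
        tensor_class_hom[OF module_aug_ker[OF X]]])
  then show "words_to_tensors R a X \<in> mod_hom R (ob (word_functor R (Suc a)) X) (ob (tensor_aug a) X)"
    unfolding words_to_tensors_def[abs_def] by (simp add: word_functor_def tensor_aug_ob)
next
  fix X Y :: "'x set" and f :: "'x \<Rightarrow> 'x" and A
  assume X: "X \<in> fin_sets" and Y: "Y \<in> fin_sets" and f: "f \<in> X \<rightarrow>\<^sub>E Y"
    and "A \<in> carrier (ob (word_functor R (Suc a)) X)"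
  then obtain \<phi> where \<phi>: "A = {\<phi>}" "\<phi> \<in> carrier (free_module R (words R (Suc a) X))"
    by (auto simp: word_functor_def singletons_def)
  have f': "f \<in> X \<rightarrow> Y" using f by auto
  have d: "free_map R (differences R) \<phi> \<in> carrier (free_module R (tuples (aug_ker R X) a))"
    by (rule free_map_closed[OF \<phi>(2) differences_closed])
  have "free_map R (differences R) (free_map R (map (free_map R f)) \<phi>) =
      free_map R (\<lambda>ms. differences R (map (free_map R f) ms)) \<phi>"
    by (rule free_map_comp[OF \<phi>(2), symmetric])
  also have "\<dots> = free_map R (\<lambda>ms. map (free_map R f) (differences R ms)) \<phi>"
    by (rule free_map_cong[OF \<phi>(2)]) (rule differences_map[OF _ f'])
  also have "\<dots> = free_map R (map (free_map R f)) (free_map R (differences R) \<phi>)"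
    by (rule free_map_comp[OF \<phi>(2)])
  finally show "words_to_tensors R a Y (mor (word_functor R (Suc a)) X Y f A) =
      mor (tensor_aug a) X Y f (words_to_tensors R a X A)"
    by (simp add: words_to_tensors_def tensor_aug_mor[OF X Y f d] word_functor_def \<phi>(1))
qed

lemma words_to_tensors_gen:
  "words_to_tensors R a X {free_gen R (map (free_gen R) (y # ys))} =
    tensor_class R (aug_ker R X) a (free_gen R (map (\<lambda>x. free_diff R (free_gen R x) (free_gen R y)) ys))"
  by (simp add: words_to_tensors_def free_map_gen differences_word del: list.map)

text \<open>For any \<open>y \<in> X\<close> the tensors of differences \<open>[x] - [y]\<close> generate the tensor power at \<open>X\<close>, and they are
  the images of the words that begin with \<open>y\<close>.\<close>

lemma words_to_tensors_epi:
  "epi R (word_functor R (Suc a)) (tensor_aug a) (words_to_tensors R a :: 'x set \<Rightarrow> _)"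
  unfolding epi_def
proof (intro conjI allI impI words_to_tensors_nat)
  fix H :: "('x, 'a, (('x \<Rightarrow> 'a) list \<Rightarrow> 'a) set) fin_functor" and \<eta> \<theta>
  assume H: "is_functor R H" and \<eta>: "nat_trans R (tensor_aug a) H \<eta>" and \<theta>: "nat_trans R (tensor_aug a) H \<theta>"
    and eq: "nat_eq (word_functor R (Suc a)) (\<lambda>X. \<eta> X \<circ> words_to_tensors R a X) (\<lambda>X. \<theta> X \<circ> words_to_tensors R a X)"
  show "nat_eq (tensor_aug a) \<eta> \<theta>" unfolding nat_eq_def
  proof (intro ballI)
    fix X :: "'x set" and t assume X: "X \<in> fin_sets" and t: "t \<in> carrier (ob (tensor_aug a) X)"
    from X obtain y where "y \<in> X" by (auto simp: fin_sets_def)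
    then obtain X' where X': "X = insert y X'" "y \<notin> X'" "finite X'"
      using X by (metis fin_sets_def finite_insert mk_disjoint_insert mem_Collect_eq)
    let ?M = "aug_ker R X" and ?d = "\<lambda>x. free_diff R (free_gen R x) (free_gen R y)"
    have M: "module R ?M" by (rule module_aug_ker[OF X])
    have "module R (ob H X)" using H X by (simp add: is_functor_def)
    moreover have "\<eta> X \<in> mod_hom R (tensor_power R ?M a) (ob H X)" "\<theta> X \<in> mod_hom R (tensor_power R ?M a) (ob H X)"
      using \<eta> \<theta> X by (simp_all add: nat_trans_def tensor_aug_ob)
    ultimately have W: "submodule {t \<in> carrier (tensor_power R ?M a). \<eta> X t = \<theta> X t} R (tensor_power R ?M a)"
      by (intro equalizer_submodule module_tensor_power M)
    have B: "?d ` X' \<subseteq> carrier ?M" using X' by (auto intro!: free_diff_gen_closed)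
    have gen: "gen_submodule R ?M (?d ` X') = carrier ?M"
      unfolding X'(1) by (rule aug_ker_spanned[OF X'(3,2)])
    have "carrier (tensor_power R ?M a) \<subseteq> {t \<in> carrier (tensor_power R ?M a). \<eta> X t = \<theta> X t}"
    proof (rule tensor_power_generated[OF M B gen W])
      fix us assume us: "length us = a" "set us \<subseteq> ?d ` X'"
      from image_list[OF us(2)] obtain ys where ys: "us = map ?d ys" "set ys \<subseteq> X'" "length ys = length us" .
      have "map (free_gen R) (y # ys) \<in> words R (Suc a) X"
        unfolding words_def using ys us(1) X'(1) by (intro CollectI exI[of _ "y # ys"]) auto
      then have c: "{free_gen R (map (free_gen R) (y # ys))} \<in> carrier (ob (word_functor R (Suc a)) X)"
        by (simp add: word_functor_def singletons_def free_gen_closed del: list.map)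
      have "tensor_class R ?M a (free_gen R us) = words_to_tensors R a X {free_gen R (map (free_gen R) (y # ys))}"
        unfolding words_to_tensors_gen ys(1) ..
      moreover have "words_to_tensors R a X \<in> mod_hom R (ob (word_functor R (Suc a)) X) (tensor_power R ?M a)"
        using words_to_tensors_nat[of a] X unfolding nat_trans_def tensor_aug_ob by blast
      note mod_homD(1)[OF this c]
      moreover have "\<eta> X (words_to_tensors R a X {free_gen R (map (free_gen R) (y # ys))}) =
          \<theta> X (words_to_tensors R a X {free_gen R (map (free_gen R) (y # ys))})"
        using eq X c by (simp add: nat_eq_def del: list.map)
      ultimately show "tensor_class R ?M a (free_gen R us) \<in> {t \<in> carrier (tensor_power R ?M a). \<eta> X t = \<theta> X t}"
        by simp
    qed
    then show "\<eta> X t = \<theta> X t" using t by (auto simp: tensor_aug_ob)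
  qed
qed

end

section \<open>Natural maps from tensors to words\<close>

context cring
begin

text \<open>A tensor of \<open>a\<close> differences \<open>[x] - [z]\<close> misses one of the \<open>a + 1\<close> points of \<open>X\<close>, so it comes from a
  smaller set, and by naturality so does its image.\<close>

lemma nat_trans_supported_on_proper_subsets:
  assumes X: "finite (X :: 'x set)" "card X = Suc a" "z \<notin> X"
    and \<theta>: "nat_trans R (tensor_aug a) (word_functor R n) \<theta>"
    and t: "t \<in> carrier (tensor_power R (aug_ker R (insert z X)) a)"
  shows "the_elem (\<theta> (insert z X) t) \<in> carrier (free_module R (\<Union>x \<in> X. words R n (insert z X - {x})))"
proof -
  let ?Y = "insert z X" and ?d = "\<lambda>x. free_diff R (free_gen R x) (free_gen R z)"
  let ?V = "carrier (free_module R (\<Union>x \<in> X. words R n (?Y - {x})))"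
  let ?M = "aug_ker R ?Y" and ?N = "free_module R (words R n ?Y)"
  have Y: "?Y \<in> fin_sets" using X by (simp add: fin_sets_def)
  have M: "module R ?M" by (rule module_aug_ker[OF Y])
  have B: "?d ` X \<subseteq> carrier ?M" by (auto intro!: free_diff_gen_closed)
  have "words R n (?Y - {x}) \<subseteq> words R n ?Y" for x by (fastforce simp: words_def)
  then have V: "submodule ?V R ?N" by (intro submodule_free_subset) blast
  have "\<theta> ?Y \<in> mod_hom R (tensor_power R ?M a) (singletons ?N)"
    using \<theta> Y by (simp add: nat_trans_def tensor_aug_ob, simp add: word_functor_def)
  then have hom: "(\<lambda>t. the_elem (\<theta> ?Y t)) \<in> mod_hom R (tensor_power R ?M a) ?N"
    by (rule mod_hom_comp[OF _ singletons_hom(1)])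
  let ?W = "{t \<in> carrier (tensor_power R ?M a). the_elem (\<theta> ?Y t) \<in> ?V}"
  have "carrier (tensor_power R ?M a) \<subseteq> ?W"
  proof (rule tensor_power_generated[OF M B aug_ker_spanned[OF X(1,3)]])
    show "submodule ?W R (tensor_power R ?M a)"
      by (rule preimage_submodule[OF module_tensor_power[OF M] module_free hom V])
    fix us assume us: "length us = a" "set us \<subseteq> ?d ` X"
    from image_list[OF us(2)] obtain xs where xs: "us = map ?d xs" "set xs \<subseteq> X" "length xs = length us" .
    have "card (set xs) < card X" using card_length[of xs] xs(3) us(1) X(2) by simp
    then obtain x where x: "x \<in> X" "x \<notin> set xs" using xs(2) by (metis less_irrefl subset_antisym subsetI)
    let ?S = "?Y - {x}"
    have S: "?S \<in> fin_sets" "?S \<subseteq> ?Y" using X x by (auto simp: fin_sets_def)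
    have i: "(\<lambda>s\<in>?S. s) \<in> ?S \<rightarrow>\<^sub>E ?Y" by auto
    have "z \<in> ?S" "\<And>s. s \<in> set xs \<Longrightarrow> s \<in> ?S" using x xs(2) X(3) by auto
    then have usS: "us \<in> tuples (aug_ker R ?S) a"
      unfolding tuples_def using us(1) by (auto simp: xs(1) intro!: free_diff_gen_closed)
    let ?t = "tensor_class R (aug_ker R ?S) a (free_gen R us)"
    have tS: "?t \<in> carrier (tensor_power R (aug_ker R ?S) a)"
      by (rule mod_homD(1)[OF tensor_class_hom[OF module_aug_ker[OF S(1)]] free_gen_closed[OF usS]])
    then have \<theta>t: "\<theta> ?S ?t \<in> carrier (ob (word_functor R n) ?S)"
      by (intro nat_transD(2)[OF \<theta> S(1)]) (simp add: tensor_aug_ob)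
    have "\<theta> ?Y (tensor_class R ?M a (free_gen R us)) = \<theta> ?Y (mor (tensor_aug a) ?S ?Y (\<lambda>s\<in>?S. s) ?t)"
      by (simp only: inclusion_tensor[OF S(2,1) Y usS])
    also have "\<dots> = mor (word_functor R n) ?S ?Y (\<lambda>s\<in>?S. s) (\<theta> ?S ?t)"
      by (rule nat_transD(3)[OF \<theta> S(1) Y i]) (simp add: tensor_aug_ob tS)
    also have "\<dots> = \<theta> ?S ?t" by (rule inclusion_word[OF S(2) \<theta>t])
    finally have "the_elem (\<theta> ?Y (tensor_class R ?M a (free_gen R us))) \<in> carrier (free_module R (words R n ?S))"
      using \<theta>t by (auto simp: word_functor_def singletons_def)
    then have "the_elem (\<theta> ?Y (tensor_class R ?M a (free_gen R us))) \<in> ?V"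
      using x(1) by (auto simp: free_simps(1))
    moreover have "us \<in> tuples ?M a" using us B by (auto simp: tuples_def)
    then have "tensor_class R ?M a (free_gen R us) \<in> carrier (tensor_power R ?M a)"
      by (intro mod_homD(1)[OF tensor_class_hom[OF M]] free_gen_closed)
    ultimately show "tensor_class R ?M a (free_gen R us) \<in> ?W" by simp
  qed
  then show ?thesis using t by blast
qed

text \<open>The words that a section produces at \<open>X\<close> have a repeated letter, so the determinant vanishes on
  their images in the tensor power, whereas it is \<open>1\<close> on the tensor of the differences from one point
  of \<open>X\<close> to the \<open>a\<close> others.\<close>

lemma no_section:
  assumes "\<one> \<noteq> \<zero>" and inf: "infinite (UNIV :: 'x set)"
    and \<theta>: "nat_trans R (tensor_aug a) (word_functor R (Suc a)) (\<theta> :: 'x set \<Rightarrow> _)"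
    and sec: "nat_eq (tensor_aug a) (\<lambda>X. words_to_tensors R a X \<circ> \<theta> X) (\<lambda>X t. t)"
  shows False
proof -
  obtain P :: "'x set" where P: "finite P" "card P = Suc (Suc a)"
    using infinite_arbitrarily_large[OF inf] by blast
  from finite_distinct_list[OF P(1)] obtain ps where ps: "set ps = P" "distinct ps" by blast
  then have "length ps = Suc (Suc a)" using distinct_card[OF ps(2)] P(2) by simp
  then obtain z y ys where zys: "ps = z # y # ys" and ys: "length ys = a"
    by (auto simp: length_Suc_conv)
  with ps(2) have d: "distinct (z # y # ys)" by simp
  define X where "X = set (y # ys)"
  let ?Y = "insert z X" and ?M = "aug_ker R X"
  have Xc: "finite X" "card X = Suc a" "z \<notin> X" using d ys by (auto simp: X_def distinct_card)
  have X: "X \<in> fin_sets" "?Y \<in> fin_sets" by (auto simp: fin_sets_def X_def)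
  have M: "module R ?M" by (rule module_aug_ker[OF X(1)])
  let ?L = "free_module R (tuples ?M a)"
  let ?us = "map (\<lambda>x. free_diff R (free_gen R x) (free_gen R y)) ys"
  let ?u = "tensor_class R ?M a (free_gen R ?us)"
  have us: "?us \<in> tuples ?M a" using ys by (auto simp: tuples_def X_def intro!: free_diff_gen_closed)
  have u: "?u \<in> carrier (tensor_power R ?M a)"
    by (intro mod_homD(1)[OF tensor_class_hom[OF M]] free_gen_closed us)
  have \<theta>u: "\<theta> X ?u \<in> carrier (ob (word_functor R (Suc a)) X)"
    by (intro nat_transD(2)[OF \<theta> X(1)]) (simp add: tensor_aug_ob u)
  then obtain \<phi> where \<phi>: "\<theta> X ?u = {\<phi>}" "\<phi> \<in> carrier (free_module R (words R (Suc a) X))"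
    by (auto simp: word_functor_def singletons_def)

  \<comment> \<open>The words in \<open>\<theta> X ?u\<close> do not change under the inclusion of \<open>X\<close> into \<open>?Y\<close>, where each of them
    misses a point of \<open>X\<close>.\<close>
  have i: "(\<lambda>x\<in>X. x) \<in> X \<rightarrow>\<^sub>E ?Y" by auto
  have "\<theta> ?Y (mor (tensor_aug a) X ?Y (\<lambda>x\<in>X. x) ?u) = mor (word_functor R (Suc a)) X ?Y (\<lambda>x\<in>X. x) (\<theta> X ?u)"
    by (rule nat_transD(3)[OF \<theta> X i]) (simp add: tensor_aug_ob u)
  also have "\<dots> = {\<phi>}" using inclusion_word[OF _ \<theta>u, of ?Y] \<phi>(1) by auto
  finally have \<phi>Y: "\<theta> ?Y (mor (tensor_aug a) X ?Y (\<lambda>x\<in>X. x) ?u) = {\<phi>}" .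
  have "mor (tensor_aug a) X ?Y (\<lambda>x\<in>X. x) ?u = tensor_class R (aug_ker R ?Y) a (free_gen R ?us)"
    by (rule inclusion_tensor[OF _ X us]) auto
  moreover have "?us \<in> tuples (aug_ker R ?Y) a"
    using ys by (auto simp: tuples_def X_def intro!: free_diff_gen_closed)
  ultimately have "mor (tensor_aug a) X ?Y (\<lambda>x\<in>X. x) ?u \<in> carrier (tensor_power R (aug_ker R ?Y) a)"
    using mod_homD(1)[OF tensor_class_hom[OF module_aug_ker[OF X(2)]] free_gen_closed] by simp
  from nat_trans_supported_on_proper_subsets[OF Xc \<theta> this]
  have \<phi>V: "\<phi> \<in> carrier (free_module R (\<Union>x \<in> X. words R (Suc a) (?Y - {x})))"
    by (simp add: \<phi>Y)

  have gen_inj: "x = x'" if "free_gen R x = free_gen R x'" for x x' :: 'x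
    using fun_cong[OF that, of x] assms(1) by (simp add: free_gen_def split: if_splits)
  let ?S = "{map (free_gen R) xs | xs. length xs = Suc a \<and> set xs \<subseteq> X \<and> \<not> distinct xs}"
  have S: "ms \<in> ?S" if "\<phi> ms \<noteq> \<zero>" for ms
  proof -
    have "ms \<in> words R (Suc a) X" using that \<phi>(2) by (auto simp: free_simps(1))
    then obtain xs where xs: "ms = map (free_gen R) xs" "length xs = Suc a" "set xs \<subseteq> X"
      by (auto simp: words_def)
    have "ms \<in> (\<Union>x \<in> X. words R (Suc a) (?Y - {x}))" using that \<phi>V unfolding free_simps(1) by blast
    then obtain x xs' where x: "x \<in> X" "ms = map (free_gen R) xs'" "set xs' \<subseteq> ?Y - {x}"
      unfolding words_def by blast
    have "xs = xs'" using xs(1) x(2) gen_inj by (metis list.inj_map_strong)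
    then have "set xs \<subset> X" using xs x by auto
    then have "card (set xs) < length xs" using xs(2) Xc psubset_card_mono by metis
    then have "\<not> distinct xs" using distinct_card by fastforce
    then show ?thesis using xs by blast
  qed
  have \<phi>S: "\<phi> \<in> carrier (free_module R ?S)"
    using \<phi>(2) S by (auto simp: free_simps(1))
  have SL: "differences R \<in> ?S \<rightarrow> tuples ?M a"
    using differences_closed by (fastforce simp: words_def)

  \<comment> \<open>The determinant of the image of \<open>\<phi>\<close> is zero, since this holds for every single word in \<open>?S\<close>.\<close>
  let ?U = "free_module R (UNIV :: unit set)"
  let ?h = "\<lambda>\<psi> (_ :: unit). lin_ext R (leibniz R ys) \<psi>"
  have vals: "length vs = length ys" "\<forall>v \<in> set vs. \<forall>s. v s \<in> carrier R" if "vs \<in> tuples ?M a" for vs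
    using that ys by (auto simp: tuples_def aug_ker_simps free_simps(1))
  have h: "?h \<in> mod_hom R ?L ?U"
    by (intro lin_ext_hom funcsetI leibniz_closed vals)
  have hd: "(\<lambda>\<psi>. ?h (free_map R (differences R) \<psi>)) \<in> mod_hom R (free_module R ?S) ?U"
    by (rule mod_hom_comp[OF free_map_hom[OF SL] h])
  have "carrier (free_module R ?S) \<subseteq>
      {\<psi> \<in> carrier (free_module R ?S). ?h (free_map R (differences R) \<psi>) = \<zero>\<^bsub>?U\<^esub>}"
  proof (rule free_module_spanned[OF mod_hom_kernel_submodule[OF module_free module_free hd]])
    fix ms assume ms: "ms \<in> ?S"
    then obtain xs where xs: "ms = map (free_gen R) xs" "length xs = Suc (length ys)" "\<not> distinct xs"
      using ys by auto
    have "leibniz R ys (differences R ms) = \<zero>"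
      unfolding xs(1) by (rule leibniz_differences_nondistinct[OF xs(2,3)])
    then show "free_gen R ms \<in> {\<psi> \<in> carrier (free_module R ?S). ?h (free_map R (differences R) \<psi>) = \<zero>\<^bsub>?U\<^esub>}"
      using free_gen_closed[OF ms] by (simp add: free_map_gen lin_ext_gen free_simps(2))
  qed
  then have "?h (free_map R (differences R) \<phi>) = \<zero>\<^bsub>?U\<^esub>" using \<phi>S by blast
  then have h0: "lin_ext R (leibniz R ys) (free_map R (differences R) \<phi>) = \<zero>"
    by (simp add: free_simps(2) fun_eq_iff)
  have h1: "lin_ext R (leibniz R ys) (free_gen R ?us) = \<one>"
    using leibniz_unit[of y ys] d by (simp add: lin_ext_gen)

  have "words_to_tensors R a X (\<theta> X ?u) = ?u"
    using sec X(1) u unfolding nat_eq_def tensor_aug_ob comp_def by blast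
  then have class_eq: "tensor_class R ?M a (free_map R (differences R) \<phi>) = ?u"
    unfolding \<phi>(1) words_to_tensors_def the_elem_eq .
  have dL: "free_map R (differences R) \<phi> \<in> carrier ?L"
    by (rule free_map_closed[OF \<phi>S SL])
  have gL: "free_gen R ?us \<in> carrier ?L" by (rule free_gen_closed[OF us])
  interpret L: module R ?L by (rule module_free)
  interpret U: module R ?U by (rule module_free)
  have "free_map R (differences R) \<phi> \<oplus>\<^bsub>?L\<^esub> \<ominus>\<^bsub>?L\<^esub> free_gen R ?us \<in> tensor_ker R ?M a"
    using class_eq tensor_class_eq_iff[OF M dL gL] by simp
  then have "lin_ext R (leibniz R ys) (free_map R (differences R) \<phi> \<oplus>\<^bsub>?L\<^esub> \<ominus>\<^bsub>?L\<^esub> free_gen R ?us) = \<zero>"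
    using leibniz_tensor_ker[OF X(1)] ys by simp
  then have "\<zero>\<^bsub>?U\<^esub> = ?h (free_map R (differences R) \<phi> \<oplus>\<^bsub>?L\<^esub> \<ominus>\<^bsub>?L\<^esub> free_gen R ?us)"
    by (simp add: free_simps(2))
  also have "\<dots> = ?h (free_map R (differences R) \<phi>) \<oplus>\<^bsub>?U\<^esub> \<ominus>\<^bsub>?U\<^esub> ?h (free_gen R ?us)"
    using mod_homD(2)[OF h dL L.a_inv_closed[OF gL]]
      mod_hom_minus[OF L.module_axioms U.module_axioms h gL] by simp
  also have "?h (free_gen R ?us) = (\<lambda>_. \<one>)" unfolding h1 ..
  also have "?h (free_map R (differences R) \<phi>) = (\<lambda>_. \<zero>)" unfolding h0 ..
  also have "\<ominus>\<^bsub>?U\<^esub> (\<lambda>_. \<one>) = (\<lambda>_. \<ominus> \<one>)" by (rule free_minus) (simp add: free_simps(1))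
  finally have "\<zero> = \<ominus> \<one>" by (simp add: free_simps fun_eq_iff)
  then show False using assms(1) by (metis minus_minus minus_zero one_closed)
qed

end

theorem corollary2:
  fixes R :: "('k, 'r) ring_scheme" and a :: nat
  assumes "cring R"
    and "\<one>\<^bsub>R\<^esub> \<noteq> \<zero>\<^bsub>R\<^esub>"
    and "infinite (UNIV :: 'x set)"
  shows "\<not> projective R
    (tensor_power_functor R (aug_ker_functor R :: ('x, 'k, 'x \<Rightarrow> 'k) fin_functor) a)"
proof
  interpret cring R by fact
  let ?T = "tensor_aug a :: ('x, 'k, (('x \<Rightarrow> 'k) list \<Rightarrow> 'k) set) fin_functor"
  assume P: "projective R ?T"
  have T: "is_functor R ?T" by (intro is_functor_tensor_power is_functor_aug_ker assms(1))
  have "nat_trans R ?T ?T (\<lambda>X t. t)" by (auto simp: nat_trans_def mod_hom_def)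
  with P T is_functor_word words_to_tensors_epi
  obtain \<theta> where "nat_trans R ?T (word_functor R (Suc a)) \<theta>"
    "nat_eq ?T (\<lambda>X. words_to_tensors R a X \<circ> \<theta> X) (\<lambda>X t. t)"
    unfolding projective_def by meson
  then show False by (rule no_section[OF assms(2,3)])
qed

end
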